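(* The optimal solution to problem (P5) is, for all $n,i,j$, $$P^{*(n)}_{S2R}=\frac{10\,\lambda^{*(n)}_7}{\lambda_4^*\ln10},$$ $$P^{*(n)}_{R2SU,i}=\frac{\frac{\mu_1B^{(n)}_{R2SU,i}}{\mu_2Q\ln2}}{\lambda^{*(n)}_{8,SU,i}A^{(n)}_{P,SU,i}+\lambda^{*(n)}_{12}}-\frac1{A^{(n)}_{P,SU,i}},\qquad P^{*(n)}_{R2CU,j}=\frac{\frac{B^{(n)}_{R2CU,j}}{\ln2}}{\lambda^{*(n)}_{8,CU,j}A^{(n)}_{P,CU,j}+\lambda^{*(n)}_{12}}-\frac1{A^{(n)}_{P,CU,j}},$$ $$\boldsymbol\ell^{*(n)}_R=(x^{*(n)}_R,y^{*(n)}_R,H_R),$$ $$\hat r^{*(n)}_{S2R}=E^{(n)}-\ln\left(\frac{\lambda^{*(n)}_7}{\lambda^{*(n)}_{11'}}\right),$$ $$\hat\gamma^{*(n)}_{R2SU,i}=\frac{\lambda^{*(n)}_{8,SU,i}+\lambda^{*(n)}_{9',SU,i}\big(2^{\hat\eta^{(n)}_{R2SU,i}}-1\big)}{2\lambda^{*(n)}_{9',SU,i}},\qquad \hat\gamma^{*(n)}_{R2CU,j}=\frac{\lambda^{*(n)}_{8,CU,j}+\lambda^{*(n)}_{9',CU,j}\big(2^{\hat\eta^{(n)}_{R2CU,j}}-1\big)}{2\lambda^{*(n)}_{9',CU,j}},$$ where $$E^{(n)}=\varepsilon_Q^{-1}\Big[\tfrac{Q}{\mu_1B^{(n)}_{S2R}}\big(\hat\Gamma^{(n)}_{sum,SU}+\hat\Gamma^{(n)}_{sum,CU}\big)\Big],\quad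 A^{(n)}_{P,SU,i}=\frac{\hat H^{(n)}_{R2SU,i}}{B^{(n)}_{R2SU,i}N_0},\quad A^{(n)}_{P,CU,j}=\frac{\hat H^{(n)}_{R2CU,j}}{B^{(n)}_{R2CU,j}N_0},$$ $$x^{*(n)}_R=\frac{\sum_i\lambda^{*(n)}_{6',SU,i}x^{(n)}_{SU,i}+\sum_j\lambda^{*(n)}_{6',CU,j}x^{(n)}_{CU,j}}{\sum_i\lambda^{*(n)}_{6',SU,i}+\sum_j\lambda^{*(n)}_{6',CU,j}},\qquad y^{*(n)}_R=\frac{\sum_i\lambda^{*(n)}_{6',SU,i}y^{(n)}_{SU,i}+\sum_j\lambda^{*(n)}_{6',CU,j}y^{(n)}_{CU,j}}{\sum_i\lambda^{*(n)}_{6',SU,i}+\sum_j\lambda^{*(n)}_{6',CU,j}},$$ and the optimal dual variables $\{\lambda_m^*\}$ are obtained via the primal–dual algorithm.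
   Context: Indices: $n\in\mathcal N=\{1,\dots,N\}$ (UAV relays, each serving one cluster of ground users), $i\in\{1,\dots,I^{(n)}\}$ (semantic users of cluster $n$), $j\in\{1,\dots,J^{(n)}\}$ (conventional users of cluster $n$). Given constants: $\mu_1,\mu_2,Q$ (semantic coding parameters), $N_0$ (noise power spectral density), $\beta_0,\alpha$ (path-loss parameters), $\zeta_0$ (computation-power coefficient), $\tilde P_S,\tilde P_R$ (satellite and UAV power budgets), $H_R$ (fixed UAV height), $h^{(n)}_{S2R}$ (satellite-to-UAV channel coefficients). The semantic similarity function is the generalized logistic function $\varepsilon_Q(x)=a_1+\frac{a_2}{1+\exp(-c_1x-c_2)}$ with constants $a_1,a_2,c_1,c_2$, and $\varepsilon_Q^{-1}$ is its inverse function. User positions are $\boldsymbol\ell^{(n)}_{SU,i}=(x^{(n)}_{SU,i},y^{(n)}_{SU,i},0)$ and $\boldsymbol\ell^{(n)}_{CU,j}=(x^{(n)}_{CU,j},y^{(n)}_{CU,j},0)$. Fixed in this problem: bandwidths $B^{(n)}_{S2R},B^{(n)}_{R2SU,i},B^{(n)}_{R2CU,j}$; channel-gain bounds $\hat H^{(n)}_{R2SU,i},\hat H^{(n)}_{R2CU,j}$; spectral-efficiency bounds $\hat\eta^{(n)}_{R2SU,i},\hat\eta^{(n)}_{R2CU,j}$; computation-frequency bounds $\hat\nu^{(n)}$. Put $\hat\Gamma^{(n)}_{sum,SU}=\sum_i\frac{\mu_1B^{(n)}_{R2SU,i}\hat\eta^{(n)}_{R2SU,i}}{\mu_2Q}$,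 $\hat\Gamma^{(n)}_{sum,CU}=\sum_jB^{(n)}_{R2CU,j}\hat\eta^{(n)}_{R2CU,j}$, and $$\mathcal F_{obj}=\sum_n\sum_i\frac{\mu_1B^{(n)}_{R2SU,i}}{\mu_2Q}\log_2\Big(1+\frac{\hat H^{(n)}_{R2SU,i}P^{(n)}_{R2SU,i}}{B^{(n)}_{R2SU,i}N_0}\Big)+\sum_n\sum_jB^{(n)}_{R2CU,j}\log_2\Big(1+\frac{\hat H^{(n)}_{R2CU,j}P^{(n)}_{R2CU,j}}{B^{(n)}_{R2CU,j}N_0}\Big).$$ Problem (P5): minimize $-\mathcal F_{obj}$ over the powers $P^{(n)}_{S2R},P^{(n)}_{R2SU,i},P^{(n)}_{R2CU,j}$, the UAV positions $\boldsymbol\ell^{(n)}_R=(x^{(n)}_R,y^{(n)}_R,H_R)$ (fixed height $H_R$), and the SNR bounds $\hat r^{(n)}_{S2R}$ (in dB), $\hat\gamma^{(n)}_{R2SU,i},\hat\gamma^{(n)}_{R2CU,j}$, subject to the following constraints, each listed with its dual variable (the remaining constraints of the overall model, on total bandwidths and computation frequency, do not involve these variables and concern only the fixed quantities): - $\lambda_4$: $\sum_nP^{(n)}_{S2R}-\tilde P_S\le0$; - $\lambda^{(n)}_{6',SU,i}$: $\|\boldsymbol\ell^{(n)}_R-\boldsymbol\ell^{(n)}_{SU,i}\|^2-\big[\beta_0/\hat H^{(n)}_{R2SU,i}\big]^{2/\alpha}\le0$; $\lambda^{(n)}_{6',CU,j}$: $\|\boldsymbol\ell^{(n)}_R-\boldsymbol\ell^{(n)}_{CU,j}\|^2-\big[\beta_0/\hat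 H^{(n)}_{R2CU,j}\big]^{2/\alpha}\le0$; - $\lambda^{(n)}_7$: $\hat r^{(n)}_{S2R}-10\log_{10}\frac{|h^{(n)}_{S2R}|^2P^{(n)}_{S2R}}{N_0B^{(n)}_{S2R}}\le0$; - $\lambda^{(n)}_{8,SU,i}$: $\frac{\hat H^{(n)}_{R2SU,i}P^{(n)}_{R2SU,i}}{B^{(n)}_{R2SU,i}N_0}-\hat\gamma^{(n)}_{R2SU,i}\le0$; $\lambda^{(n)}_{8,CU,j}$: $\frac{\hat H^{(n)}_{R2CU,j}P^{(n)}_{R2CU,j}}{B^{(n)}_{R2CU,j}N_0}-\hat\gamma^{(n)}_{R2CU,j}\le0$; - $\lambda^{(n)}_{9',SU,i}$: $(\hat\gamma^{(n)}_{R2SU,i})^2-(2^{\hat\eta^{(n)}_{R2SU,i}}-1)\hat\gamma^{(n)}_{R2SU,i}\le0$; $\lambda^{(n)}_{9',CU,j}$: $(\hat\gamma^{(n)}_{R2CU,j})^2-(2^{\hat\eta^{(n)}_{R2CU,j}}-1)\hat\gamma^{(n)}_{R2CU,j}\le0$; - $\lambda^{(n)}_{11'}$: $\exp\Big(\varepsilon_Q^{-1}\big[\tfrac{Q}{\mu_1B^{(n)}_{S2R}}(\hat\Gamma^{(n)}_{sum,SU}+\hat\Gamma^{(n)}_{sum,CU})\big]-\hat r^{(n)}_{S2R}\Big)-1\le0$; - $\lambda^{(n)}_{12}$: $\zeta_0(\hat\nu^{(n)})^3+\sum_iP^{(n)}_{R2SU,i}+\sum_jP^{(n)}_{R2CU,j}-\tilde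 P_R\le0$. Problem (P5) is convex and satisfies Slater's condition, so strong duality holds and the KKT conditions are applied to solve it optimally. The primal–dual algorithm alternately updates the primal variables by the formulas above (with current dual variables) and each dual variable $\lambda$ by adding a step size times the partial derivative of the Lagrangian with respect to $\lambda$, until convergence.
   Formalization: Formulas for P_S2R, position, r and gamma are asserted only where their denominators are nonzero (Slater makes most 0/0); the algorithm is shown to give optimal duals only if it converges, with positive non-summable steps, to a nonnegative limit where the formulas are defined. *)

theory Defs
  imports "HOL-Analysis.Analysis"
begin

text \<open>
  Relays are indexed by \<open>n \<in> {1..num_relays}\<close>, semantic users of cluster \<open>n\<close> by
  \<open>i \<in> {1..num_SU n}\<close> and conventional users by \<open>j \<in> {1..num_CU n}\<close>. Families are total
  functions on \<open>nat\<close>; only their values at these indices matter.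
\<close>

record p5_data =
  num_relays :: nat
  num_SU :: "nat \<Rightarrow> nat"
  num_CU :: "nat \<Rightarrow> nat"
  mu1 :: real
  mu2 :: real
  sem_Q :: real
  noise :: real
  beta0 :: real
  pl_alpha :: real
  zeta0 :: real
  PS_max :: real
  PR_max :: real
  height :: real
  chan :: "nat \<Rightarrow> complex"
  log_a1 :: real
  log_a2 :: real
  log_c1 :: real
  log_c2 :: real
  xSU :: "nat \<Rightarrow> nat \<Rightarrow> real"
  ySU :: "nat \<Rightarrow> nat \<Rightarrow> real"
  xCU :: "nat \<Rightarrow> nat \<Rightarrow> real"
  yCU :: "nat \<Rightarrow> nat \<Rightarrow> real"
  B_S2R :: "nat \<Rightarrow> real"
  B_SU :: "nat \<Rightarrow> nat \<Rightarrow> real"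
  B_CU :: "nat \<Rightarrow> nat \<Rightarrow> real"
  H_SU :: "nat \<Rightarrow> nat \<Rightarrow> real"
  H_CU :: "nat \<Rightarrow> nat \<Rightarrow> real"
  eta_SU :: "nat \<Rightarrow> nat \<Rightarrow> real"
  eta_CU :: "nat \<Rightarrow> nat \<Rightarrow> real"
  nu :: "nat \<Rightarrow> real"

record p5_vars =
  P_S2R :: "nat \<Rightarrow> real"
  P_SU :: "nat \<Rightarrow> nat \<Rightarrow> real"
  P_CU :: "nat \<Rightarrow> nat \<Rightarrow> real"
  xR :: "nat \<Rightarrow> real"
  yR :: "nat \<Rightarrow> real"
  r_S2R :: "nat \<Rightarrow> real"
  gam_SU :: "nat \<Rightarrow> nat \<Rightarrow> real"
  gam_CU :: "nat \<Rightarrow> nat \<Rightarrow> real"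

abbreviation relays :: "p5_data \<Rightarrow> nat set" where
  "relays D \<equiv> {1..num_relays D}"

abbreviation SUs :: "p5_data \<Rightarrow> nat \<Rightarrow> nat set" where
  "SUs D n \<equiv> {1..num_SU D n}"

abbreviation CUs :: "p5_data \<Rightarrow> nat \<Rightarrow> nat set" where
  "CUs D n \<equiv> {1..num_CU D n}"

definition eps_Q :: "p5_data \<Rightarrow> real \<Rightarrow> real" where
  "eps_Q D x = log_a1 D + log_a2 D / (1 + exp (- log_c1 D * x - log_c2 D))"

definition Gamma_SU :: "p5_data \<Rightarrow> nat \<Rightarrow> real" where
  "Gamma_SU D n = (\<Sum>i\<in>SUs D n. mu1 D * B_SU D n i * eta_SU D n i / (mu2 D * sem_Q D))"

definition Gamma_CU :: "p5_data \<Rightarrow> nat \<Rightarrow> real" where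
  "Gamma_CU D n = (\<Sum>j\<in>CUs D n. B_CU D n j * eta_CU D n j)"

definition sim_level :: "p5_data \<Rightarrow> nat \<Rightarrow> real" where
  "sim_level D n = sem_Q D / (mu1 D * B_S2R D n) * (Gamma_SU D n + Gamma_CU D n)"

definition E_const :: "p5_data \<Rightarrow> nat \<Rightarrow> real" where
  "E_const D n = inv (eps_Q D) (sim_level D n)"

definition A_SU :: "p5_data \<Rightarrow> nat \<Rightarrow> nat \<Rightarrow> real" where
  "A_SU D n i = H_SU D n i / (B_SU D n i * noise D)"

definition A_CU :: "p5_data \<Rightarrow> nat \<Rightarrow> nat \<Rightarrow> real" where
  "A_CU D n j = H_CU D n j / (B_CU D n j * noise D)"

text \<open>
  Physical parameters are positive. The last three conditions make \<open>inv (eps_Q D)\<close> a genuine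
  inverse at the point where it is used.
\<close>

definition p5_wf :: "p5_data \<Rightarrow> bool" where
  "p5_wf D \<longleftrightarrow>
     mu1 D > 0 \<and> mu2 D > 0 \<and> sem_Q D > 0 \<and> noise D > 0 \<and> beta0 D > 0 \<and> pl_alpha D > 0 \<and>
     (\<forall>n\<in>relays D. B_S2R D n > 0 \<and> chan D n \<noteq> 0 \<and>
        (\<forall>i\<in>SUs D n. B_SU D n i > 0 \<and> H_SU D n i > 0) \<and>
        (\<forall>j\<in>CUs D n. B_CU D n j > 0 \<and> H_CU D n j > 0)) \<and>
     log_a2 D \<noteq> 0 \<and> log_c1 D \<noteq> 0 \<and> (\<forall>n\<in>relays D. sim_level D n \<in> range (eps_Q D))"

definition uav_pos :: "p5_data \<Rightarrow> p5_vars \<Rightarrow> nat \<Rightarrow> real \<times> real \<times> real" where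
  "uav_pos D v n = (xR v n, yR v n, height D)"

definition pos_SU :: "p5_data \<Rightarrow> nat \<Rightarrow> nat \<Rightarrow> real \<times> real \<times> real" where
  "pos_SU D n i = (xSU D n i, ySU D n i, 0)"

definition pos_CU :: "p5_data \<Rightarrow> nat \<Rightarrow> nat \<Rightarrow> real \<times> real \<times> real" where
  "pos_CU D n j = (xCU D n j, yCU D n j, 0)"

definition F_obj :: "p5_data \<Rightarrow> p5_vars \<Rightarrow> real" where
  "F_obj D v =
     (\<Sum>n\<in>relays D. \<Sum>i\<in>SUs D n. mu1 D * B_SU D n i / (mu2 D * sem_Q D) *
        log 2 (1 + H_SU D n i * P_SU v n i / (B_SU D n i * noise D))) +
     (\<Sum>n\<in>relays D. \<Sum>j\<in>CUs D n. B_CU D n j *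
        log 2 (1 + H_CU D n j * P_CU v n j / (B_CU D n j * noise D)))"

text \<open>
  The constraints, each identified with its dual variable: a vector of dual variables is a
  function \<open>p5_con \<Rightarrow> real\<close>. \<open>C6\<close>, \<open>C9\<close> and \<open>C11\<close> belong to the dual variables written with a
  prime.
\<close>

datatype p5_con =
    C4
  | C6_SU nat nat
  | C6_CU nat nat
  | C7 nat
  | C8_SU nat nat
  | C8_CU nat nat
  | C9_SU nat nat
  | C9_CU nat nat
  | C11 nat
  | C12 nat

definition p5_cons :: "p5_data \<Rightarrow> p5_con set" where
  "p5_cons D =
     {C4} \<union> (\<Union>n\<in>relays D.
       {C7 n, C11 n, C12 n} \<union>
       (\<Union>i\<in>SUs D n. {C6_SU n i, C8_SU n i, C9_SU n i}) \<union>
       (\<Union>j\<in>CUs D n. {C6_CU n j, C8_CU n j, C9_CU n j}))"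

fun con_fun :: "p5_data \<Rightarrow> p5_con \<Rightarrow> p5_vars \<Rightarrow> real" where
  "con_fun D C4 v = (\<Sum>n\<in>relays D. P_S2R v n) - PS_max D"
| "con_fun D (C6_SU n i) v =
     (norm (uav_pos D v n - pos_SU D n i))\<^sup>2 - (beta0 D / H_SU D n i) powr (2 / pl_alpha D)"
| "con_fun D (C6_CU n j) v =
     (norm (uav_pos D v n - pos_CU D n j))\<^sup>2 - (beta0 D / H_CU D n j) powr (2 / pl_alpha D)"
| "con_fun D (C7 n) v =
     r_S2R v n - 10 * log 10 ((cmod (chan D n))\<^sup>2 * P_S2R v n / (noise D * B_S2R D n))"
| "con_fun D (C8_SU n i) v = H_SU D n i * P_SU v n i / (B_SU D n i * noise D) - gam_SU v n i"
| "con_fun D (C8_CU n j) v = H_CU D n j * P_CU v n j / (B_CU D n j * noise D) - gam_CU v n j"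
| "con_fun D (C9_SU n i) v = (gam_SU v n i)\<^sup>2 - (2 powr eta_SU D n i - 1) * gam_SU v n i"
| "con_fun D (C9_CU n j) v = (gam_CU v n j)\<^sup>2 - (2 powr eta_CU D n j - 1) * gam_CU v n j"
| "con_fun D (C11 n) v = exp (E_const D n - r_S2R v n) - 1"
| "con_fun D (C12 n) v =
     zeta0 D * nu D n ^ 3 + (\<Sum>i\<in>SUs D n. P_SU v n i) + (\<Sum>j\<in>CUs D n. P_CU v n j) - PR_max D"

text \<open>
  The implicit domain of the problem: every logarithm occurring in the objective or in a
  constraint has a positive argument. It has to be explicit because \<^const>\<open>ln\<close> is total.
\<close>

definition p5_domain :: "p5_data \<Rightarrow> p5_vars set" where
  "p5_domain D = {v. \<forall>n\<in>relays D.
     (cmod (chan D n))\<^sup>2 * P_S2R v n / (noise D * B_S2R D n) > 0 \<and>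
     (\<forall>i\<in>SUs D n. 1 + H_SU D n i * P_SU v n i / (B_SU D n i * noise D) > 0) \<and>
     (\<forall>j\<in>CUs D n. 1 + H_CU D n j * P_CU v n j / (B_CU D n j * noise D) > 0)}"

definition p5_feasible :: "p5_data \<Rightarrow> p5_vars set" where
  "p5_feasible D = {v \<in> p5_domain D. \<forall>m\<in>p5_cons D. con_fun D m v \<le> 0}"

definition p5_optimal :: "p5_data \<Rightarrow> p5_vars \<Rightarrow> bool" where
  "p5_optimal D v \<longleftrightarrow>
     v \<in> p5_feasible D \<and> (\<forall>w\<in>p5_feasible D. - F_obj D v \<le> - F_obj D w)"

definition slater :: "p5_data \<Rightarrow> bool" where
  "slater D \<longleftrightarrow> (\<exists>v\<in>p5_domain D. \<forall>m\<in>p5_cons D. con_fun D m v < 0)"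

definition lagrangian :: "p5_data \<Rightarrow> p5_vars \<Rightarrow> (p5_con \<Rightarrow> real) \<Rightarrow> real" where
  "lagrangian D v lam = - F_obj D v + (\<Sum>m\<in>p5_cons D. lam m * con_fun D m v)"

definition dual_fun :: "p5_data \<Rightarrow> (p5_con \<Rightarrow> real) \<Rightarrow> ereal" where
  "dual_fun D lam = (INF v\<in>p5_domain D. ereal (lagrangian D v lam))"

definition dual_feasible :: "p5_data \<Rightarrow> (p5_con \<Rightarrow> real) set" where
  "dual_feasible D = {lam. \<forall>m\<in>p5_cons D. lam m \<ge> 0}"

definition dual_optimal :: "p5_data \<Rightarrow> (p5_con \<Rightarrow> real) \<Rightarrow> bool" where
  "dual_optimal D lam \<longleftrightarrow>
     lam \<in> dual_feasible D \<and> (\<forall>lam'\<in>dual_feasible D. dual_fun D lam' \<le> dual_fun D lam)"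

definition strong_duality :: "p5_data \<Rightarrow> bool" where
  "strong_duality D \<longleftrightarrow>
     (SUP lam\<in>dual_feasible D. dual_fun D lam) = (INF v\<in>p5_feasible D. ereal (- F_obj D v))"

definition pos_weight :: "p5_data \<Rightarrow> (p5_con \<Rightarrow> real) \<Rightarrow> nat \<Rightarrow> real" where
  "pos_weight D lam n = (\<Sum>i\<in>SUs D n. lam (C6_SU n i)) + (\<Sum>j\<in>CUs D n. lam (C6_CU n j))"

definition closed_form :: "p5_data \<Rightarrow> (p5_con \<Rightarrow> real) \<Rightarrow> p5_vars" where
  "closed_form D lam = \<lparr>
     P_S2R = (\<lambda>n. 10 * lam (C7 n) / (lam C4 * ln 10)),
     P_SU = (\<lambda>n i. (mu1 D * B_SU D n i / (mu2 D * sem_Q D * ln 2)) /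
               (lam (C8_SU n i) * A_SU D n i + lam (C12 n)) - 1 / A_SU D n i),
     P_CU = (\<lambda>n j. (B_CU D n j / ln 2) /
               (lam (C8_CU n j) * A_CU D n j + lam (C12 n)) - 1 / A_CU D n j),
     xR = (\<lambda>n. ((\<Sum>i\<in>SUs D n. lam (C6_SU n i) * xSU D n i) +
               (\<Sum>j\<in>CUs D n. lam (C6_CU n j) * xCU D n j)) / pos_weight D lam n),
     yR = (\<lambda>n. ((\<Sum>i\<in>SUs D n. lam (C6_SU n i) * ySU D n i) +
               (\<Sum>j\<in>CUs D n. lam (C6_CU n j) * yCU D n j)) / pos_weight D lam n),
     r_S2R = (\<lambda>n. E_const D n - ln (lam (C7 n) / lam (C11 n))),
     gam_SU = (\<lambda>n i. (lam (C8_SU n i) + lam (C9_SU n i) * (2 powr eta_SU D n i - 1)) /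
               (2 * lam (C9_SU n i))),
     gam_CU = (\<lambda>n j. (lam (C8_CU n j) + lam (C9_CU n j) * (2 powr eta_CU D n j - 1)) /
               (2 * lam (C9_CU n j)))\<rparr>"

definition closed_form_defined :: "p5_data \<Rightarrow> (p5_con \<Rightarrow> real) \<Rightarrow> bool" where
  "closed_form_defined D lam \<longleftrightarrow>
     lam C4 \<noteq> 0 \<and>
     (\<forall>n\<in>relays D. pos_weight D lam n \<noteq> 0 \<and> lam (C11 n) \<noteq> 0 \<and> lam (C7 n) / lam (C11 n) > 0 \<and>
        (\<forall>i\<in>SUs D n. lam (C8_SU n i) * A_SU D n i + lam (C12 n) \<noteq> 0 \<and> lam (C9_SU n i) \<noteq> 0) \<and>
        (\<forall>j\<in>CUs D n. lam (C8_CU n j) * A_CU D n j + lam (C12 n) \<noteq> 0 \<and> lam (C9_CU n j) \<noteq> 0))"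

text \<open>
  One run of the primal-dual algorithm, from arbitrary initial dual variables \<open>lam 0\<close> and with
  step size \<open>s k m\<close> for the dual variable \<open>m\<close> in iteration \<open>k\<close>.
\<close>

definition primal_dual_run ::
    "p5_data \<Rightarrow> (nat \<Rightarrow> p5_con \<Rightarrow> real) \<Rightarrow> (nat \<Rightarrow> p5_vars) \<Rightarrow> (nat \<Rightarrow> p5_con \<Rightarrow> real) \<Rightarrow> bool" where
  "primal_dual_run D s v lam \<longleftrightarrow>
     (\<forall>k. v k = closed_form D (lam k) \<and>
       (\<forall>m\<in>p5_cons D.
          lam (Suc k) m =
            lam k m + s k m * deriv (\<lambda>t. lagrangian D (v k) ((lam k)(m := t))) (lam k m)))"

end

theory Submission
  imports Defs
begin

text \<open>
  Slater's condition yields multipliers by eliminating the constraints one at a time, which needs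
  no separating hyperplane. Strong duality makes an optimal point a minimizer of the Lagrangian
  over the whole domain, and the Lagrangian is, up to a constant, a sum of convex functions of one
  variable each; the closed form is the coordinatewise stationarity condition. In the algorithm a
  dual variable grows by its step size times the constraint value; as the step sizes are not
  summable, convergence forces every constraint value to vanish at the limit, so the limit is a
  saddle point.
\<close>

section \<open>Lagrange multipliers under Slater's condition\<close>

text \<open>The primal variables form a record without vector space operations or a topology.
  Convexity is therefore phrased through a mixing operation \<open>mix\<close>, and a multiplier is
  obtained as a supremum of real quotients, which the Slater point keeps finite.

  The Lagrangian separates although the power budgets \<open>C4\<close> and \<open>C12\<close>
  couple many variables, because that coupling is linear. The users of a cluster share one UAV
  position, but a weighted sum of parabolas is again a parabola, with its vertex at the weighted
  mean of the user positions.

  Division and \<open>ln\<close> are total, so the explicit domain and the conditions on nonzero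
  multipliers carry real content: they decide where a stationarity equation may be solved for the
  primal variable.

  The dual update is not projected onto the nonnegative reals. A multiplier can drift in either
  direction, which is why a limit makes the constraint value zero and not merely nonpositive;
  feasibility and complementary slackness then come together.\<close>

definition convex_wrt :: "(real \<Rightarrow> 'a \<Rightarrow> 'a \<Rightarrow> 'a) \<Rightarrow> 'a set \<Rightarrow> ('a \<Rightarrow> real) \<Rightarrow> bool" where
  "convex_wrt mix X f \<longleftrightarrow>
     (\<forall>x\<in>X. \<forall>y\<in>X. \<forall>t\<in>{0..1}. f (mix t x y) \<le> (1 - t) * f x + t * f y)"

lemma convex_wrtD:
  "convex_wrt mix X f \<Longrightarrow> x \<in> X \<Longrightarrow> y \<in> X \<Longrightarrow> 0 \<le> t \<Longrightarrow> t \<le> 1 \<Longrightarrow>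
    f (mix t x y) \<le> (1 - t) * f x + t * f y"
  by (simp add: convex_wrt_def)

lemma convex_wrt_subset: "convex_wrt mix X f \<Longrightarrow> Y \<subseteq> X \<Longrightarrow> convex_wrt mix Y f"
  unfolding convex_wrt_def by blast

lemma convex_wrt_add_mult:
  assumes "convex_wrt mix X f" "convex_wrt mix X g" "0 \<le> l"
  shows "convex_wrt mix X (\<lambda>x. f x + l * g x)"
  unfolding convex_wrt_def
proof (intro ballI)
  fix x y and t :: real assume xy: "x \<in> X" "y \<in> X" "t \<in> {0..1}"
  have "f (mix t x y) \<le> (1 - t) * f x + t * f y"
    "g (mix t x y) \<le> (1 - t) * g x + t * g y"
    using assms(1,2) xy by (auto simp: convex_wrt_def)
  then have "f (mix t x y) + l * g (mix t x y)
      \<le> ((1 - t) * f x + t * f y) + l * ((1 - t) * g x + t * g y)"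
    using assms(3) by (intro add_mono mult_left_mono)
  then show "f (mix t x y) + l * g (mix t x y)
      \<le> (1 - t) * (f x + l * g x) + t * (f y + l * g y)"
    by (simp add: algebra_simps)
qed

lemma single_multiplier:
  fixes f g :: "'a \<Rightarrow> real"
  assumes closed: "\<And>x y t. x \<in> X \<Longrightarrow> y \<in> X \<Longrightarrow> 0 \<le> t \<Longrightarrow> t \<le> 1 \<Longrightarrow> mix t x y \<in> X"
    and f: "convex_wrt mix X f" and g: "convex_wrt mix X g"
    and x0: "x0 \<in> X" "g x0 < 0"
    and p: "\<And>x. x \<in> X \<Longrightarrow> g x \<le> 0 \<Longrightarrow> p \<le> f x"
  shows "\<exists>l\<ge>0. \<forall>x\<in>X. p \<le> f x + l * g x"
proof -
  \<comment> \<open>The points with \<open>g x > 0\<close> bound the multiplier from below, those with \<open>g y < 0\<close> from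
    above; a convex combination with \<open>g \<le> 0\<close> shows that the bounds are compatible.\<close>
  define S where "S = insert 0 {(p - f x) / g x | x. x \<in> X \<and> g x > 0}"
  have upper: "s \<le> (f y - p) / (- g y)" if y: "y \<in> X" "g y < 0" and s: "s \<in> S" for s y
  proof (cases "s = 0")
    case True
    then show ?thesis using p[of y] y by (simp add: divide_nonneg_neg)
  next
    case False
    then obtain x where x: "x \<in> X" "g x > 0" and sx: "s = (p - f x) / g x"
      using s by (auto simp: S_def)
    \<comment> \<open>The weight at which the chord of \<open>g\<close> from \<open>x\<close> to
      \<open>y\<close> crosses zero; convexity puts the mixed point into the region where
      \<open>p\<close> bounds \<open>f\<close>.\<close>
    define t where "t = g x / (g x - g y)"
    have t: "0 \<le> t" "t \<le> 1" using x y by (auto simp: t_def)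
    have d: "g x - g y > 0" using x y by simp
    have "(1 - t) * g x + t * g y = 0" using d by (simp add: t_def field_simps)
    then have "g (mix t x y) \<le> 0"
      using convex_wrtD[OF g x(1) y(1) t] by simp
    then have "p \<le> (1 - t) * f x + t * f y"
      using p[OF closed[OF x(1) y(1) t]] convex_wrtD[OF f x(1) y(1) t] by linarith
    then have "p * (g x - g y) \<le> ((1 - t) * f x + t * f y) * (g x - g y)"
      using d by (simp add: mult_right_mono)
    also have "\<dots> = (1 - t) * (g x - g y) * f x + t * (g x - g y) * f y"
      by (simp add: algebra_simps)
    also have "\<dots> = - g y * f x + g x * f y"
      using d by (simp add: t_def left_diff_distrib)
    finally have "(p - f x) * (- g y) \<le> (f y - p) * g x"
      by (simp add: algebra_simps)
    then show ?thesis using x y by (simp add: sx field_simps)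
  qed
  \<comment> \<open>The strictly feasible point supplies a finite upper bound; the element 0 of
    \<open>S\<close> makes the supremum nonnegative and \<open>S\<close> nonempty.\<close>
  have bdd: "bdd_above S" using upper[OF x0] by (meson bdd_above.I)
  have "0 \<le> Sup S" using bdd by (intro cSup_upper) (auto simp: S_def)
  moreover have "p \<le> f x + Sup S * g x" if x: "x \<in> X" for x
  proof (cases "g x" "0 :: real" rule: linorder_cases)
    case less
    have "Sup S \<le> (f x - p) / (- g x)"
      using upper[OF x less] by (intro cSup_least) (auto simp: S_def)
    then show ?thesis using less by (simp add: field_simps)
  next
    case equal
    then show ?thesis using p[OF x] by simp
  next
    case greater
    have "(p - f x) / g x \<le> Sup S"
      using bdd x greater by (intro cSup_upper) (auto simp: S_def)
    then show ?thesis using greater by (simp add: field_simps)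
  qed
  ultimately show ?thesis by blast
qed

text \<open>The induction generalizes over \<open>f\<close>: a constraint that has received its
  multiplier is added to the objective, which stays convex for the remaining constraints. The bound
  \<open>p\<close> need not be attained.\<close>

lemma slater_multipliers:
  fixes f :: "'a \<Rightarrow> real" and g :: "'m \<Rightarrow> 'a \<Rightarrow> real"
  assumes "finite M"
    and closed: "\<And>x y t. x \<in> X \<Longrightarrow> y \<in> X \<Longrightarrow> 0 \<le> t \<Longrightarrow> t \<le> 1 \<Longrightarrow> mix t x y \<in> X"
    and "convex_wrt mix X f" and "\<And>m. m \<in> M \<Longrightarrow> convex_wrt mix X (g m)"
    and "x0 \<in> X" and "\<And>m. m \<in> M \<Longrightarrow> g m x0 < 0"
    and "\<And>x. x \<in> X \<Longrightarrow> (\<And>m. m \<in> M \<Longrightarrow> g m x \<le> 0) \<Longrightarrow> p \<le> f x"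
  shows "\<exists>l. (\<forall>m\<in>M. 0 \<le> l m) \<and> (\<forall>x\<in>X. p \<le> f x + (\<Sum>m\<in>M. l m * g m x))"
  using assms(1,3-)
proof (induction M arbitrary: f rule: finite_induct)
  case empty
  then show ?case by simp
next
  case (insert a M)
  \<comment> \<open>The multiplier of the constraint \<open>a\<close> is chosen on the region cut out by the others.\<close>
  define Y where "Y = {x\<in>X. \<forall>m\<in>M. g m x \<le> 0}"
  have "\<exists>l\<ge>0. \<forall>x\<in>Y. p \<le> f x + l * g a x"
  proof (rule single_multiplier[where mix = mix and ?x0.0 = x0])
    fix x y and t :: real assume xyt: "x \<in> Y" "y \<in> Y" "0 \<le> t" "t \<le> 1"
    have "g m (mix t x y) \<le> 0" if m: "m \<in> M" for m
    proof -
      have "g m (mix t x y) \<le> (1 - t) * g m x + t * g m y"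
        using xyt m by (intro convex_wrtD[OF insert.prems(2)]) (auto simp: Y_def)
      also have "\<dots> \<le> 0 + 0"
        using xyt m by (intro add_mono mult_nonneg_nonpos) (auto simp: Y_def)
      finally show ?thesis by simp
    qed
    then show "mix t x y \<in> Y" using xyt closed by (auto simp: Y_def)
  next
    show "convex_wrt mix Y f" using insert.prems(1)
      by (rule convex_wrt_subset) (auto simp: Y_def)
    show "convex_wrt mix Y (g a)" using insert.prems(2)[of a]
      by (rule convex_wrt_subset) (auto simp: Y_def)
    show "x0 \<in> Y" using insert.prems(3,4) by (auto simp: Y_def intro: less_imp_le)
    show "g a x0 < 0" using insert.prems(4) by simp
    show "p \<le> f x" if "x \<in> Y" "g a x \<le> 0" for x
      using that by (intro insert.prems(5)) (auto simp: Y_def)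
  qed
  then obtain la where la: "0 \<le> la" "\<And>x. x \<in> Y \<Longrightarrow> p \<le> f x + la * g a x" by blast
  have "\<exists>l. (\<forall>m\<in>M. 0 \<le> l m) \<and> (\<forall>x\<in>X. p \<le> (f x + la * g a x) + (\<Sum>m\<in>M. l m * g m x))"
  proof (rule insert.IH)
    show "convex_wrt mix X (\<lambda>x. f x + la * g a x)"
      using insert.prems(1,2) la(1) by (intro convex_wrt_add_mult) auto
    \<comment> \<open>Here \<open>g a x\<close> may be positive: a violation of the constraint
      \<open>a\<close> is already paid for by \<open>la\<close>.\<close>
    show "p \<le> f x + la * g a x" if "x \<in> X" "\<And>m. m \<in> M \<Longrightarrow> g m x \<le> 0" for x
      using that by (intro la(2)) (auto simp: Y_def)
  qed (use insert.prems in auto)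
  then obtain l where l: "\<And>m. m \<in> M \<Longrightarrow> 0 \<le> l m"
    "\<And>x. x \<in> X \<Longrightarrow> p \<le> (f x + la * g a x) + (\<Sum>m\<in>M. l m * g m x)" by blast
  have "(\<Sum>m\<in>insert a M. (l(a := la)) m * g m x) = la * g a x + (\<Sum>m\<in>M. l m * g m x)" for x
  proof -
    have "(\<Sum>m\<in>M. (l(a := la)) m * g m x) = (\<Sum>m\<in>M. l m * g m x)"
      using insert.hyps(2) by (intro sum.cong) auto
    then show ?thesis using insert.hyps by simp
  qed
  then show ?case using l la(1) by (intro exI[of _ "l(a := la)"]) (auto simp: add.assoc)
qed

section \<open>Convexity of the problem\<close>

text \<open>The segment between two points, spelled out by coordinates; the weight \<open>t\<close>
  sits on the second point, as in \<open>convex_onD\<close>.\<close>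

definition p5_mix :: "real \<Rightarrow> p5_vars \<Rightarrow> p5_vars \<Rightarrow> p5_vars" where
  "p5_mix t v w = \<lparr>
     P_S2R = (\<lambda>n. (1 - t) * P_S2R v n + t * P_S2R w n),
     P_SU = (\<lambda>n i. (1 - t) * P_SU v n i + t * P_SU w n i),
     P_CU = (\<lambda>n j. (1 - t) * P_CU v n j + t * P_CU w n j),
     xR = (\<lambda>n. (1 - t) * xR v n + t * xR w n),
     yR = (\<lambda>n. (1 - t) * yR v n + t * yR w n),
     r_S2R = (\<lambda>n. (1 - t) * r_S2R v n + t * r_S2R w n),
     gam_SU = (\<lambda>n i. (1 - t) * gam_SU v n i + t * gam_SU w n i),
     gam_CU = (\<lambda>n j. (1 - t) * gam_CU v n j + t * gam_CU w n j)\<rparr>"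

lemma finite_p5_cons [simp]: "finite (p5_cons D)"
  by (simp add: p5_cons_def)

lemma log_concave:
  fixes b x y t :: real
  assumes "1 < b" "0 < x" "0 < y" "0 \<le> t" "t \<le> 1"
  shows "(1 - t) * log b x + t * log b y \<le> log b ((1 - t) * x + t * y)"
  using convex_onD[OF minus_log_convex[OF assms(1)] assms(4,5), of x y] assms(2,3)
  by (simp add: algebra_simps)

lemma square_convex:
  fixes x y t :: real
  assumes "0 \<le> t" "t \<le> 1"
  shows "((1 - t) * x + t * y)\<^sup>2 \<le> (1 - t) * x\<^sup>2 + t * y\<^sup>2"
proof -
  have "(1 - t) * x\<^sup>2 + t * y\<^sup>2 - ((1 - t) * x + t * y)\<^sup>2 = t * (1 - t) * (x - y)\<^sup>2"
    by (simp add: power2_eq_square algebra_simps)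
  then show ?thesis using assms
    by (metis diff_ge_0_iff_ge mult_nonneg_nonneg zero_le_power2)
qed

lemma convex_combination_pos:
  fixes x y t :: real
  assumes "0 < x" "0 < y" "0 \<le> t" "t \<le> 1"
  shows "0 < (1 - t) * x + t * y"
proof (cases "t = 0")
  case False
  with assms have "0 < t * y" "0 \<le> (1 - t) * x" by auto
  then show ?thesis by linarith
qed (use assms in simp)

text \<open>The shape is that of the logarithm arguments in the objective. Treating
  \<open>c / d\<close> as a single factor covers \<open>d = 0\<close> as well.\<close>

lemma affine_combination:
  fixes a c d x y t :: real
  shows "a + c * ((1 - t) * x + t * y) / d = (1 - t) * (a + c * x / d) + t * (a + c * y / d)"
proof -
  define k where "k = c / d"
  have "c * z / d = k * z" for z by (simp add: k_def)
  then show ?thesis by (simp only:) (simp add: algebra_simps)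
qed

lemma scaled_combination:
  fixes c d x y t :: real
  shows "c * ((1 - t) * x + t * y) / d = (1 - t) * (c * x / d) + t * (c * y / d)"
  using affine_combination[of 0 c t x y d] by simp

lemma p5_domain_mix:
  assumes "v \<in> p5_domain D" "w \<in> p5_domain D" "0 \<le> t" "t \<le> 1"
  shows "p5_mix t v w \<in> p5_domain D"
  \<comment> \<open>The affine arguments are rewritten before the scaled one, whose pattern also
    matches inside them.\<close>
  using assms unfolding p5_domain_def p5_mix_def mem_Collect_eq p5_vars.simps affine_combination
  unfolding scaled_combination
  by (intro ballI conjI convex_combination_pos; blast)

lemma norm_sq_uav:
  "(norm (uav_pos D v n - pos_SU D n i))\<^sup>2 =
     (xR v n - xSU D n i)\<^sup>2 + (yR v n - ySU D n i)\<^sup>2 + (height D)\<^sup>2"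
  "(norm (uav_pos D v n - pos_CU D n i))\<^sup>2 =
     (xR v n - xCU D n i)\<^sup>2 + (yR v n - yCU D n i)\<^sup>2 + (height D)\<^sup>2"
  by (simp_all add: uav_pos_def pos_SU_def pos_CU_def norm_prod_def)

lemma convex_sq_diff:
  fixes x y t c :: real
  assumes "0 \<le> t" "t \<le> 1"
  shows "((1 - t) * x + t * y - c)\<^sup>2 \<le> (1 - t) * (x - c)\<^sup>2 + t * (y - c)\<^sup>2"
  using square_convex[OF assms, of "x - c" "y - c"] by (simp add: algebra_simps)

lemma convex_log_affine:
  fixes b a c d x y t :: real
  assumes "1 < b" "0 < a + c * x / d" "0 < a + c * y / d" "0 \<le> t" "t \<le> 1"
  shows "(1 - t) * log b (a + c * x / d) + t * log b (a + c * y / d)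
    \<le> log b (a + c * ((1 - t) * x + t * y) / d)"
  unfolding affine_combination by (rule log_concave[OF assms])

text \<open>\<open>C4\<close>, \<open>C8\<close> and \<open>C12\<close> are affine,
  \<open>C6\<close> and \<open>C9\<close> are quadratic with leading coefficient 1, and
  \<open>C11\<close> is the exponential of an affine function. Convexity of \<open>C7\<close> is
  concavity of the logarithm, valid where its argument is positive, that is, on the domain.\<close>

lemma convex_con_fun:
  assumes "m \<in> p5_cons D"
  shows "convex_wrt p5_mix (p5_domain D) (con_fun D m)"
  unfolding convex_wrt_def
proof (intro ballI)
  fix v w and t :: real
  assume vw: "v \<in> p5_domain D" "w \<in> p5_domain D" and "t \<in> {0..1}"
  then have t: "0 \<le> t" "t \<le> 1" by auto
  show "con_fun D m (p5_mix t v w) \<le> (1 - t) * con_fun D m v + t * con_fun D m w"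
  proof (cases m)
    case C4
    then show ?thesis
      by (simp add: p5_mix_def sum.distrib sum_distrib_left[symmetric]) (simp add: algebra_simps)
  next
    case (C6_SU n i)
    then show ?thesis
      using convex_sq_diff[OF t, of "xR v n" "xR w n" "xSU D n i"]
        convex_sq_diff[OF t, of "yR v n" "yR w n" "ySU D n i"]
      by (simp add: norm_sq_uav) (simp add: p5_mix_def algebra_simps)
  next
    case (C6_CU n i)
    then show ?thesis
      using convex_sq_diff[OF t, of "xR v n" "xR w n" "xCU D n i"]
        convex_sq_diff[OF t, of "yR v n" "yR w n" "yCU D n i"]
      by (simp add: norm_sq_uav) (simp add: p5_mix_def algebra_simps)
  next
    case (C7 n)
    then have "n \<in> relays D" using assms by (auto simp: p5_cons_def)
    \<comment> \<open>The leading \<open>0 +\<close> casts the argument in the form of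
      \<open>convex_log_affine\<close> with \<open>a = 0\<close>.\<close>
    then have "(1 - t) * log 10 (0 + (cmod (chan D n))\<^sup>2 * P_S2R v n / (noise D * B_S2R D n))
        + t * log 10 (0 + (cmod (chan D n))\<^sup>2 * P_S2R w n / (noise D * B_S2R D n))
      \<le> log 10 (0 + (cmod (chan D n))\<^sup>2 * ((1 - t) * P_S2R v n + t * P_S2R w n) /
          (noise D * B_S2R D n))"
      using vw t by (intro convex_log_affine) (auto simp: p5_domain_def)
    then show ?thesis using C7 by (simp add: p5_mix_def algebra_simps)
  next
    case (C8_SU n i)
    then show ?thesis by (simp add: p5_mix_def add_divide_distrib diff_divide_distrib algebra_simps)
  next
    case (C8_CU n i)
    then show ?thesis by (simp add: p5_mix_def add_divide_distrib diff_divide_distrib algebra_simps)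
  next
    case (C9_SU n i)
    then show ?thesis using square_convex[OF t, of "gam_SU v n i" "gam_SU w n i"]
      by (simp add: p5_mix_def algebra_simps)
  next
    case (C9_CU n i)
    then show ?thesis using square_convex[OF t, of "gam_CU v n i" "gam_CU w n i"]
      by (simp add: p5_mix_def algebra_simps)
  next
    case (C11 n)
    have "exp ((1 - t) * (E_const D n - r_S2R v n) + t * (E_const D n - r_S2R w n))
      \<le> (1 - t) * exp (E_const D n - r_S2R v n) + t * exp (E_const D n - r_S2R w n)"
      using convex_onD[OF exp_convex t, of "E_const D n - r_S2R v n" "E_const D n - r_S2R w n"]
      by simp
    then show ?thesis using C11 by (simp add: p5_mix_def algebra_simps)
  next
    case (C12 n)
    then show ?thesis
      by (simp add: p5_mix_def sum.distrib sum_distrib_left[symmetric]) (simp add: algebra_simps)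
  qed
qed

lemma convex_objective:
  assumes "p5_wf D"
  shows "convex_wrt p5_mix (p5_domain D) (\<lambda>v. - F_obj D v)"
  unfolding convex_wrt_def
proof (intro ballI)
  fix v w and t :: real
  assume vw: "v \<in> p5_domain D" "w \<in> p5_domain D" and "t \<in> {0..1}"
  then have t: "0 \<le> t" "t \<le> 1" by auto
  have su: "(1 - t) * (mu1 D * B_SU D n i / (mu2 D * sem_Q D) *
        log 2 (1 + H_SU D n i * P_SU v n i / (B_SU D n i * noise D)))
      + t * (mu1 D * B_SU D n i / (mu2 D * sem_Q D) *
        log 2 (1 + H_SU D n i * P_SU w n i / (B_SU D n i * noise D)))
      \<le> mu1 D * B_SU D n i / (mu2 D * sem_Q D) *
        log 2 (1 + H_SU D n i * P_SU (p5_mix t v w) n i / (B_SU D n i * noise D))"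
    if "n \<in> relays D" "i \<in> SUs D n" for n i
  proof -
    have "0 \<le> mu1 D * B_SU D n i / (mu2 D * sem_Q D)"
      using assms that by (auto simp: p5_wf_def intro!: divide_nonneg_pos mult_nonneg_nonneg less_imp_le)
    moreover have "(1 - t) * log 2 (1 + H_SU D n i * P_SU v n i / (B_SU D n i * noise D))
       + t * log 2 (1 + H_SU D n i * P_SU w n i / (B_SU D n i * noise D))
      \<le> log 2 (1 + H_SU D n i * ((1 - t) * P_SU v n i + t * P_SU w n i) / (B_SU D n i * noise D))"
      using vw t that by (intro convex_log_affine) (auto simp: p5_domain_def)
    ultimately show ?thesis
      unfolding p5_mix_def p5_vars.simps mult.left_commute[of t] mult.left_commute[of "1 - t"]
        distrib_left[symmetric] by (intro mult_left_mono)
  qed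
  have cu: "(1 - t) * (B_CU D n i *
        log 2 (1 + H_CU D n i * P_CU v n i / (B_CU D n i * noise D)))
      + t * (B_CU D n i *
        log 2 (1 + H_CU D n i * P_CU w n i / (B_CU D n i * noise D)))
      \<le> B_CU D n i *
        log 2 (1 + H_CU D n i * P_CU (p5_mix t v w) n i / (B_CU D n i * noise D))"
    if "n \<in> relays D" "i \<in> CUs D n" for n i
  proof -
    have "0 \<le> B_CU D n i"
      using assms that by (auto simp: p5_wf_def intro: less_imp_le)
    moreover have "(1 - t) * log 2 (1 + H_CU D n i * P_CU v n i / (B_CU D n i * noise D))
       + t * log 2 (1 + H_CU D n i * P_CU w n i / (B_CU D n i * noise D))
      \<le> log 2 (1 + H_CU D n i * ((1 - t) * P_CU v n i + t * P_CU w n i) / (B_CU D n i * noise D))"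
      using vw t that by (intro convex_log_affine) (auto simp: p5_domain_def)
    ultimately show ?thesis
      unfolding p5_mix_def p5_vars.simps mult.left_commute[of t] mult.left_commute[of "1 - t"]
        distrib_left[symmetric] by (intro mult_left_mono)
  qed
  \<comment> \<open>As atoms, the two double sums let linear arithmetic combine their concavity
    bounds.\<close>
  define S where "S u = (\<Sum>n\<in>relays D. \<Sum>i\<in>SUs D n. mu1 D * B_SU D n i / (mu2 D * sem_Q D) *
      log 2 (1 + H_SU D n i * P_SU u n i / (B_SU D n i * noise D)))" for u :: p5_vars
  define C where "C u = (\<Sum>n\<in>relays D. \<Sum>j\<in>CUs D n. B_CU D n j *
      log 2 (1 + H_CU D n j * P_CU u n j / (B_CU D n j * noise D)))" for u :: p5_vars
  have "(1 - t) * S v + t * S w \<le> S (p5_mix t v w)"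
    unfolding S_def sum_distrib_left sum.distrib[symmetric] by (intro sum_mono su)
  moreover have "(1 - t) * C v + t * C w \<le> C (p5_mix t v w)"
    unfolding C_def sum_distrib_left sum.distrib[symmetric] by (intro sum_mono cu)
  ultimately have "(1 - t) * F_obj D v + t * F_obj D w \<le> F_obj D (p5_mix t v w)"
    unfolding F_obj_def S_def[symmetric] C_def[symmetric] distrib_left by linarith
  then show "- F_obj D (p5_mix t v w) \<le> (1 - t) * - F_obj D v + t * - F_obj D w"
    by (simp add: algebra_simps)
qed

section \<open>Duality\<close>

text \<open>Each penalty term is a nonnegative multiplier times a nonpositive constraint
  value.\<close>

lemma lagrangian_le_objective:
  assumes "w \<in> p5_feasible D" "lam \<in> dual_feasible D"
  shows "lagrangian D w lam \<le> - F_obj D w"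
proof -
  have "(\<Sum>m\<in>p5_cons D. lam m * con_fun D m w) \<le> 0"
    using assms by (intro sum_nonpos mult_nonneg_nonpos) (auto simp: p5_feasible_def dual_feasible_def)
  then show ?thesis by (simp add: lagrangian_def)
qed

lemma dual_fun_le:
  "v \<in> p5_domain D \<Longrightarrow> dual_fun D lam \<le> ereal (lagrangian D v lam)"
  unfolding dual_fun_def by (rule INF_lower)

lemma weak_duality:
  assumes "w \<in> p5_feasible D" "lam \<in> dual_feasible D"
  shows "dual_fun D lam \<le> ereal (- F_obj D w)"
  using dual_fun_le[of w D lam] lagrangian_le_objective[OF assms] assms(1)
  by (simp add: p5_feasible_def) (meson ereal_less_eq(3) order_trans)

text \<open>The multipliers found for the primal value itself attain the dual supremum, so equality
  of the values and existence of a dual optimum come from the same vector. The Slater point is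
  feasible, so the primal value is not \<open>\<infinity>\<close>.\<close>

lemma slater_duality:
  assumes "p5_wf D" "slater D"
  shows "strong_duality D \<and> (\<exists>lam. dual_optimal D lam)"
proof -
  define p where "p = (INF v\<in>p5_feasible D. ereal (- F_obj D v))"
  obtain v0 where v0: "v0 \<in> p5_domain D" "\<And>m. m \<in> p5_cons D \<Longrightarrow> con_fun D m v0 < 0"
    using assms(2) by (auto simp: slater_def)
  then have "v0 \<in> p5_feasible D" by (auto simp: p5_feasible_def intro: less_imp_le)
  then have "p \<le> ereal (- F_obj D v0)" unfolding p_def by (rule INF_lower)
  then have p_fin: "p \<noteq> \<infinity>" by auto
  have weak: "dual_fun D lam \<le> p" if "lam \<in> dual_feasible D" for lam
    unfolding p_def using weak_duality[OF _ that] by (intro INF_greatest) auto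
  have "\<exists>lam\<in>dual_feasible D. p \<le> dual_fun D lam"
  proof (cases p)
    case (real r)
    have "\<exists>l. (\<forall>m\<in>p5_cons D. 0 \<le> l m) \<and>
        (\<forall>v\<in>p5_domain D. r \<le> - F_obj D v + (\<Sum>m\<in>p5_cons D. l m * con_fun D m v))"
    proof (rule slater_multipliers[where mix = p5_mix and ?x0.0 = v0])
      show "r \<le> - F_obj D v" if "v \<in> p5_domain D" "\<And>m. m \<in> p5_cons D \<Longrightarrow> con_fun D m v \<le> 0" for v
      proof -
        have "v \<in> p5_feasible D" using that by (auto simp: p5_feasible_def)
        then have "p \<le> ereal (- F_obj D v)" unfolding p_def by (rule INF_lower)
        then show ?thesis using real by simp
      qed
    qed (use v0 assms(1) in \<open>auto intro: p5_domain_mix convex_objective convex_con_fun\<close>)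
    then obtain l where "l \<in> dual_feasible D" "\<And>v. v \<in> p5_domain D \<Longrightarrow> r \<le> lagrangian D v l"
      by (auto simp: dual_feasible_def lagrangian_def)
    then show ?thesis using real
      by (intro bexI[of _ l]) (auto simp: dual_fun_def intro!: INF_greatest)
  next
    case PInf
    then show ?thesis using p_fin by simp
  next
    case MInf
    \<comment> \<open>The primal is unbounded below, so any dual feasible vector attains the
      value.\<close>
    then show ?thesis by (intro bexI[of _ "\<lambda>_. 0"]) (auto simp: dual_feasible_def)
  qed
  then obtain lam where lam: "lam \<in> dual_feasible D" "p \<le> dual_fun D lam" by blast
  have "(SUP lam\<in>dual_feasible D. dual_fun D lam) = p"
    using weak lam by (intro antisym SUP_least) (auto intro: SUP_upper2)
  moreover have "dual_optimal D lam"
    using lam weak order_trans by (auto simp: dual_optimal_def)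
  ultimately show ?thesis by (auto simp: strong_duality_def p_def)
qed

text \<open>At \<open>v\<close> the Lagrangian is at most \<open>- F_obj D v\<close>, which strong
  duality identifies with \<open>dual_fun D lam\<close>, a lower bound of the Lagrangian at every
  \<open>w\<close> in the domain.\<close>

lemma optimal_minimizes_lagrangian:
  assumes "p5_optimal D v" "dual_optimal D lam" "strong_duality D" "w \<in> p5_domain D"
  shows "lagrangian D v lam \<le> lagrangian D w lam"
proof -
  have v: "v \<in> p5_feasible D" and lam: "lam \<in> dual_feasible D"
    using assms by (auto simp: p5_optimal_def dual_optimal_def)
  have "(INF v\<in>p5_feasible D. ereal (- F_obj D v)) = ereal (- F_obj D v)"
    using assms(1) v by (intro antisym INF_lower INF_greatest) (auto simp: p5_optimal_def)
  moreover have "(SUP lam\<in>dual_feasible D. dual_fun D lam) = dual_fun D lam"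
    using assms(2) lam by (intro antisym SUP_upper SUP_least) (auto simp: dual_optimal_def)
  ultimately have "ereal (- F_obj D v) = dual_fun D lam"
    using assms(3) by (simp add: strong_duality_def)
  also have "\<dots> \<le> ereal (lagrangian D w lam)" using assms(4) by (rule dual_fun_le)
  finally show ?thesis using lagrangian_le_objective[OF v lam] by simp
qed

section \<open>The Lagrangian as a sum of one-variable costs\<close>

text \<open>One shape serves both kinds of power: \<open>a = 1\<close> for the user rates in the
  objective, \<open>a = 0\<close> for the satellite power, whose logarithm comes from
  \<open>C7\<close>.\<close>

definition log_cost :: "real \<Rightarrow> real \<Rightarrow> real \<Rightarrow> real \<Rightarrow> real \<Rightarrow> real" where
  "log_cost L w a A p = L * p - w * ln (a + A * p)"

definition exp_cost :: "real \<Rightarrow> real \<Rightarrow> real \<Rightarrow> real \<Rightarrow> real" where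
  "exp_cost l l' E r = l * r + l' * exp (E - r)"

definition quad_cost :: "real \<Rightarrow> real \<Rightarrow> real \<Rightarrow> real" where
  "quad_cost a b x = a * x\<^sup>2 - b * x"

text \<open>The conclusion is not divided by \<open>L\<close>, so for positive \<open>w\<close> it
  can itself show that \<open>L\<close> is nonzero.\<close>

lemma log_cost_minimizer:
  assumes "0 < a + A * p" "A \<noteq> 0"
    and min: "\<And>q. 0 < a + A * q \<Longrightarrow> log_cost L w a A p \<le> log_cost L w a A q"
  shows "L * (a + A * p) = w * A"
proof -
  have "(log_cost L w a A has_real_derivative (L - w * (A / (a + A * p)))) (at p)"
    unfolding log_cost_def using assms(1)
    by (auto intro!: derivative_eq_intros simp: field_simps)
  \<comment> \<open>This radius is the distance from \<open>p\<close> to the zero of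
    \<open>a + A * q\<close>, so the minimum is an interior one.\<close>
  moreover have "0 < a + A * q" if "\<bar>p - q\<bar> < (a + A * p) / \<bar>A\<bar>" for q
  proof -
    have "\<bar>A * (p - q)\<bar> < a + A * p"
      using that assms(2) unfolding abs_mult by (simp add: pos_less_divide_eq mult.commute)
    then show ?thesis by (simp add: algebra_simps)
  qed
  ultimately have "L - w * (A / (a + A * p)) = 0"
    using assms by (intro DERIV_local_min[where d = "(a + A * p) / \<bar>A\<bar>"]) auto
  then show ?thesis using assms(1) by (simp add: field_simps)
qed

text \<open>Concavity of the logarithm in the form \<open>ln z <= z - 1\<close>, with
  \<open>z\<close> the ratio of the two arguments; stationarity turns the tangent slope into
  \<open>L\<close>.\<close>

lemma log_cost_stationary:
  assumes "0 < a + A * p" "0 \<le> w" "L * (a + A * p) = w * A" "0 < a + A * q"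
  shows "log_cost L w a A p \<le> log_cost L w a A q"
proof -
  have "ln (a + A * q) - ln (a + A * p) \<le> (a + A * q) / (a + A * p) - 1"
    using assms(1,4) ln_le_minus_one[of "(a + A * q) / (a + A * p)"] by (simp add: ln_div)
  also have "\<dots> = A * (q - p) / (a + A * p)"
    using assms(1) by (simp add: field_simps)
  finally have "w * (ln (a + A * q) - ln (a + A * p)) \<le> w * (A * (q - p) / (a + A * p))"
    using assms(2) by (rule mult_left_mono)
  also have "\<dots> = w * A / (a + A * p) * (q - p)" by simp
  also have "w * A / (a + A * p) = L"
    using assms(1,3) by (simp add: field_simps)
  finally show ?thesis by (simp add: log_cost_def algebra_simps)
qed

text \<open>A zero derivative gives \<open>l / l' = exp (E - r)\<close>; the ratio is thereby
  positive and its logarithm genuine.\<close>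

lemma exp_cost_minimizer:
  assumes "l' \<noteq> 0" and min: "\<And>q. exp_cost l l' E r \<le> exp_cost l l' E q"
  shows "r = E - ln (l / l')"
proof -
  have "(exp_cost l l' E has_real_derivative (l - l' * exp (E - r))) (at r)"
    unfolding exp_cost_def by (auto intro!: derivative_eq_intros)
  then have "l - l' * exp (E - r) = 0"
    using min by (intro DERIV_local_min[where d = 1]) auto
  then have "l / l' = exp (E - r)" using assms(1) by (simp add: field_simps)
  then show ?thesis by simp
qed

lemma exp_cost_stationary:
  assumes "0 \<le> l'" "0 < l / l'"
  shows "exp_cost l l' E (E - ln (l / l')) \<le> exp_cost l l' E q"
proof -
  define r where "r = E - ln (l / l')"
  \<comment> \<open>The case \<open>l' = 0\<close> is excluded because division by zero yields 0,
    against the assumed positive ratio.\<close>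
  have l: "l = l' * exp (E - r)"
    using assms by (cases "l' = 0") (auto simp: r_def)
  have "l' * exp (E - r) * (1 + (r - q)) \<le> l' * exp (E - r) * exp (r - q)"
    using assms(1) by (intro mult_left_mono exp_ge_add_one_self) auto
  also have "\<dots> = l' * exp (E - q)" by (simp add: mult.assoc flip: exp_add)
  finally have "l + l * (r - q) \<le> l' * exp (E - q)"
    unfolding l[symmetric] by (simp add: algebra_simps)
  then show ?thesis
    using l unfolding r_def[symmetric] exp_cost_def by (simp add: algebra_simps)
qed

text \<open>Completing the square; it yields both minimality and uniqueness of the vertex.\<close>

lemma quad_cost_diff:
  assumes "a \<noteq> 0"
  shows "quad_cost a b x - quad_cost a b (b / (2 * a)) = a * (x - b / (2 * a))\<^sup>2"
  using assms by (simp add: quad_cost_def power2_eq_square field_simps)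

lemma quad_cost_minimizer:
  assumes "0 \<le> a" "a \<noteq> 0" and min: "\<And>y. quad_cost a b x \<le> quad_cost a b y"
  shows "x = b / (2 * a)"
proof -
  have "a * (x - b / (2 * a))\<^sup>2 \<le> 0"
    using min[of "b / (2 * a)"] quad_cost_diff[OF assms(2), of b x] by linarith
  then show ?thesis using assms by (simp add: mult_le_0_iff)
qed

lemma quad_cost_stationary:
  assumes "0 \<le> a" "a \<noteq> 0"
  shows "quad_cost a b (b / (2 * a)) \<le> quad_cost a b y"
proof -
  have "0 \<le> a * (y - b / (2 * a))\<^sup>2" using assms(1) by simp
  then show ?thesis using quad_cost_diff[OF assms(2), of b y] by linarith
qed

section \<open>Regrouping the Lagrangian by relay and by user\<close>

definition A_S2R :: "p5_data \<Rightarrow> nat \<Rightarrow> real" where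
  "A_S2R D n = (cmod (chan D n))\<^sup>2 / (noise D * B_S2R D n)"

definition x_moment :: "p5_data \<Rightarrow> (p5_con \<Rightarrow> real) \<Rightarrow> nat \<Rightarrow> real" where
  "x_moment D lam n = (\<Sum>i\<in>SUs D n. lam (C6_SU n i) * xSU D n i) +
     (\<Sum>j\<in>CUs D n. lam (C6_CU n j) * xCU D n j)"

definition y_moment :: "p5_data \<Rightarrow> (p5_con \<Rightarrow> real) \<Rightarrow> nat \<Rightarrow> real" where
  "y_moment D lam n = (\<Sum>i\<in>SUs D n. lam (C6_SU n i) * ySU D n i) +
     (\<Sum>j\<in>CUs D n. lam (C6_CU n j) * yCU D n j)"

text \<open>The multiplier of \<open>C8_SU\<close> enters twice, raising the price of power and
  rewarding a larger SNR bound. The distance constraint is left out, since the position belongs to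
  the whole cluster.\<close>

definition SU_cost :: "p5_data \<Rightarrow> (p5_con \<Rightarrow> real) \<Rightarrow> p5_vars \<Rightarrow> nat \<Rightarrow> nat \<Rightarrow> real" where
  "SU_cost D lam v n i =
     log_cost (lam (C8_SU n i) * A_SU D n i + lam (C12 n))
       (mu1 D * B_SU D n i / (mu2 D * sem_Q D * ln 2)) 1 (A_SU D n i) (P_SU v n i) +
     quad_cost (lam (C9_SU n i))
       (lam (C8_SU n i) + lam (C9_SU n i) * (2 powr eta_SU D n i - 1)) (gam_SU v n i)"

definition CU_cost :: "p5_data \<Rightarrow> (p5_con \<Rightarrow> real) \<Rightarrow> p5_vars \<Rightarrow> nat \<Rightarrow> nat \<Rightarrow> real" where
  "CU_cost D lam v n j =
     log_cost (lam (C8_CU n j) * A_CU D n j + lam (C12 n))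
       (B_CU D n j / ln 2) 1 (A_CU D n j) (P_CU v n j) +
     quad_cost (lam (C9_CU n j))
       (lam (C8_CU n j) + lam (C9_CU n j) * (2 powr eta_CU D n j - 1)) (gam_CU v n j)"

definition relay_cost :: "p5_data \<Rightarrow> (p5_con \<Rightarrow> real) \<Rightarrow> p5_vars \<Rightarrow> nat \<Rightarrow> real" where
  "relay_cost D lam v n =
     log_cost (lam C4) (10 * lam (C7 n) / ln 10) 0 (A_S2R D n) (P_S2R v n) +
     quad_cost (pos_weight D lam n) (2 * x_moment D lam n) (xR v n) +
     quad_cost (pos_weight D lam n) (2 * y_moment D lam n) (yR v n) +
     exp_cost (lam (C7 n)) (lam (C11 n)) (E_const D n) (r_S2R v n) +
     (\<Sum>i\<in>SUs D n. SU_cost D lam v n i) + (\<Sum>j\<in>CUs D n. CU_cost D lam v n j)"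

lemma sum_p5_cons:
  "(\<Sum>m\<in>p5_cons D. g m) = g C4 + (\<Sum>n\<in>relays D. g (C7 n) + g (C11 n) + g (C12 n) +
     (\<Sum>i\<in>SUs D n. g (C6_SU n i) + g (C8_SU n i) + g (C9_SU n i)) +
     (\<Sum>j\<in>CUs D n. g (C6_CU n j) + g (C8_CU n j) + g (C9_CU n j)))"
  for g :: "p5_con \<Rightarrow> real"
proof -
  define U where "U n = (\<Union>i\<in>SUs D n. {C6_SU n i, C8_SU n i, C9_SU n i})" for n
  define V where "V n = (\<Union>j\<in>CUs D n. {C6_CU n j, C8_CU n j, C9_CU n j})" for n
  have U: "sum g (U n) = (\<Sum>i\<in>SUs D n. g (C6_SU n i) + g (C8_SU n i) + g (C9_SU n i))" for n
    unfolding U_def by (subst sum.UNION_disjoint) (auto simp: add.assoc)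
  have V: "sum g (V n) = (\<Sum>j\<in>CUs D n. g (C6_CU n j) + g (C8_CU n j) + g (C9_CU n j))" for n
    unfolding V_def by (subst sum.UNION_disjoint) (auto simp: add.assoc)
  have W: "sum g ({C7 n, C11 n, C12 n} \<union> U n \<union> V n)
      = g (C7 n) + g (C11 n) + g (C12 n) + sum g (U n) + sum g (V n)" for n
  proof -
    have "sum g ({C7 n, C11 n, C12 n} \<union> U n \<union> V n)
        = sum g {C7 n, C11 n, C12 n} + sum g (U n) + sum g (V n)"
      by (subst sum.union_disjoint; (subst sum.union_disjoint)?) (auto simp: U_def V_def)
    then show ?thesis by (simp add: add.assoc)
  qed
  have "p5_cons D = {C4} \<union> (\<Union>n\<in>relays D. {C7 n, C11 n, C12 n} \<union> U n \<union> V n)"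
    by (simp add: p5_cons_def U_def V_def)
  then have "sum g (p5_cons D)
      = sum g {C4} + sum g (\<Union>n\<in>relays D. {C7 n, C11 n, C12 n} \<union> U n \<union> V n)"
    by (simp only:) (rule sum.union_disjoint, auto simp: U_def V_def)
  also have "sum g (\<Union>n\<in>relays D. {C7 n, C11 n, C12 n} \<union> U n \<union> V n)
      = (\<Sum>n\<in>relays D. sum g ({C7 n, C11 n, C12 n} \<union> U n \<union> V n))"
    by (rule sum.UNION_disjoint) (auto simp: U_def V_def)
  finally show ?thesis unfolding W U V by simp
qed

text \<open>What is free of primal variables: the budgets, the squared user coordinates from the
  expanded distances, and the \<open>- 1\<close> of \<open>C11\<close>. The gain in
  \<open>C7\<close> stays inside its logarithm.\<close>

definition lagrangian_offset :: "p5_data \<Rightarrow> (p5_con \<Rightarrow> real) \<Rightarrow> real" where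
  "lagrangian_offset D lam = - lam C4 * PS_max D + (\<Sum>n\<in>relays D.
     lam (C12 n) * (zeta0 D * nu D n ^ 3 - PR_max D) - lam (C11 n) +
     (\<Sum>i\<in>SUs D n. lam (C6_SU n i) * ((xSU D n i)\<^sup>2 + (ySU D n i)\<^sup>2 + (height D)\<^sup>2 -
        (beta0 D / H_SU D n i) powr (2 / pl_alpha D))) +
     (\<Sum>j\<in>CUs D n. lam (C6_CU n j) * ((xCU D n j)\<^sup>2 + (yCU D n j)\<^sup>2 + (height D)\<^sup>2 -
        (beta0 D / H_CU D n j) powr (2 / pl_alpha D))))"

lemma quad_cost_position:
  "quad_cost (pos_weight D lam n) (2 * x_moment D lam n) z =
     (\<Sum>i\<in>SUs D n. quad_cost (lam (C6_SU n i)) (2 * lam (C6_SU n i) * xSU D n i) z) +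
     (\<Sum>j\<in>CUs D n. quad_cost (lam (C6_CU n j)) (2 * lam (C6_CU n j) * xCU D n j) z)"
  "quad_cost (pos_weight D lam n) (2 * y_moment D lam n) z =
     (\<Sum>i\<in>SUs D n. quad_cost (lam (C6_SU n i)) (2 * lam (C6_SU n i) * ySU D n i) z) +
     (\<Sum>j\<in>CUs D n. quad_cost (lam (C6_CU n j)) (2 * lam (C6_CU n j) * yCU D n j) z)"
  by (simp_all add: quad_cost_def pos_weight_def x_moment_def y_moment_def sum_subtractf
      sum_distrib_left sum_distrib_right distrib_left distrib_right mult.assoc)

text \<open>The share of one semantic user, including its own summand of the UAV power budget
  \<open>C12\<close>.\<close>

lemma SU_terms:
  "lam (C6_SU n i) * con_fun D (C6_SU n i) v + lam (C8_SU n i) * con_fun D (C8_SU n i) v +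
     lam (C9_SU n i) * con_fun D (C9_SU n i) v + lam (C12 n) * P_SU v n i -
     mu1 D * B_SU D n i / (mu2 D * sem_Q D) *
       log 2 (1 + H_SU D n i * P_SU v n i / (B_SU D n i * noise D)) =
   lam (C6_SU n i) * ((xSU D n i)\<^sup>2 + (ySU D n i)\<^sup>2 + (height D)\<^sup>2 -
       (beta0 D / H_SU D n i) powr (2 / pl_alpha D)) +
     quad_cost (lam (C6_SU n i)) (2 * lam (C6_SU n i) * xSU D n i) (xR v n) +
     quad_cost (lam (C6_SU n i)) (2 * lam (C6_SU n i) * ySU D n i) (yR v n) +
     SU_cost D lam v n i"
proof -
  have "H_SU D n i * P_SU v n i / (B_SU D n i * noise D) = A_SU D n i * P_SU v n i"
    by (simp add: A_SU_def)
  \<comment> \<open>Passing to the natural logarithm is the origin of the factor \<open>ln 2\<close>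
    in the power formula.\<close>
  moreover have "mu1 D * B_SU D n i / (mu2 D * sem_Q D) * log 2 z
      = mu1 D * B_SU D n i / (mu2 D * sem_Q D * ln 2) * ln z" for z
    by (simp add: log_def)
  ultimately show ?thesis
    unfolding con_fun.simps norm_sq_uav SU_cost_def log_cost_def quad_cost_def
    by (simp only:) (simp add: power2_eq_square algebra_simps)
qed

lemma CU_terms:
  "lam (C6_CU n j) * con_fun D (C6_CU n j) v + lam (C8_CU n j) * con_fun D (C8_CU n j) v +
     lam (C9_CU n j) * con_fun D (C9_CU n j) v + lam (C12 n) * P_CU v n j -
     B_CU D n j * log 2 (1 + H_CU D n j * P_CU v n j / (B_CU D n j * noise D)) =
   lam (C6_CU n j) * ((xCU D n j)\<^sup>2 + (yCU D n j)\<^sup>2 + (height D)\<^sup>2 -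
       (beta0 D / H_CU D n j) powr (2 / pl_alpha D)) +
     quad_cost (lam (C6_CU n j)) (2 * lam (C6_CU n j) * xCU D n j) (xR v n) +
     quad_cost (lam (C6_CU n j)) (2 * lam (C6_CU n j) * yCU D n j) (yR v n) +
     CU_cost D lam v n j"
proof -
  have "H_CU D n j * P_CU v n j / (B_CU D n j * noise D) = A_CU D n j * P_CU v n j"
    by (simp add: A_CU_def)
  moreover have "B_CU D n j * log 2 z = B_CU D n j / ln 2 * ln z" for z
    by (simp add: log_def)
  ultimately show ?thesis
    unfolding con_fun.simps norm_sq_uav CU_cost_def log_cost_def quad_cost_def
    by (simp only:) (simp add: power2_eq_square algebra_simps)
qed

lemma relay_terms:
  "lam C4 * P_S2R v n + lam (C7 n) * con_fun D (C7 n) v + lam (C11 n) * con_fun D (C11 n) v =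
   log_cost (lam C4) (10 * lam (C7 n) / ln 10) 0 (A_S2R D n) (P_S2R v n) +
     exp_cost (lam (C7 n)) (lam (C11 n)) (E_const D n) (r_S2R v n) - lam (C11 n)"
proof -
  have "(cmod (chan D n))\<^sup>2 * P_S2R v n / (noise D * B_S2R D n) = A_S2R D n * P_S2R v n"
    by (simp add: A_S2R_def)
  moreover have "lam (C7 n) * (10 * log 10 z) = 10 * lam (C7 n) / ln 10 * ln z" for z
    by (simp add: log_def)
  ultimately show ?thesis
    unfolding con_fun.simps log_cost_def exp_cost_def right_diff_distrib
    by (simp only:) simp
qed

text \<open>Being linear in the powers, \<open>C4\<close> is distributed over the relays and
  \<open>C12\<close> over the users of its relay; every other constraint already belongs to one
  relay.\<close>

lemma lagrangian_eq:
  "lagrangian D v lam = lagrangian_offset D lam + (\<Sum>n\<in>relays D. relay_cost D lam v n)"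
proof -
  \<comment> \<open>The summands are made opaque so that the identities per user and per relay add
    up by linear arithmetic.\<close>
  define obj_SU where "obj_SU n i = mu1 D * B_SU D n i / (mu2 D * sem_Q D) *
    log 2 (1 + H_SU D n i * P_SU v n i / (B_SU D n i * noise D))" for n i
  define obj_CU where "obj_CU n j = B_CU D n j *
    log 2 (1 + H_CU D n j * P_CU v n j / (B_CU D n j * noise D))" for n j
  define con where "con m = lam m * con_fun D m v" for m
  define off_SU where "off_SU n i = lam (C6_SU n i) * ((xSU D n i)\<^sup>2 + (ySU D n i)\<^sup>2 +
    (height D)\<^sup>2 - (beta0 D / H_SU D n i) powr (2 / pl_alpha D))" for n i
  define off_CU where "off_CU n j = lam (C6_CU n j) * ((xCU D n j)\<^sup>2 + (yCU D n j)\<^sup>2 +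
    (height D)\<^sup>2 - (beta0 D / H_CU D n j) powr (2 / pl_alpha D))" for n j
  define off where "off n = lam (C12 n) * (zeta0 D * nu D n ^ 3 - PR_max D) - lam (C11 n)" for n
  have n: "lam C4 * P_S2R v n + con (C7 n) + con (C11 n) + con (C12 n) +
      (\<Sum>i\<in>SUs D n. con (C6_SU n i) + con (C8_SU n i) + con (C9_SU n i)) +
      (\<Sum>j\<in>CUs D n. con (C6_CU n j) + con (C8_CU n j) + con (C9_CU n j)) -
      (\<Sum>i\<in>SUs D n. obj_SU n i) - (\<Sum>j\<in>CUs D n. obj_CU n j) =
    off n + (\<Sum>i\<in>SUs D n. off_SU n i) + (\<Sum>j\<in>CUs D n. off_CU n j) + relay_cost D lam v n" for n
  proof -
    have "con (C12 n) = lam (C12 n) * (zeta0 D * nu D n ^ 3 - PR_max D) +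
        (\<Sum>i\<in>SUs D n. lam (C12 n) * P_SU v n i) + (\<Sum>j\<in>CUs D n. lam (C12 n) * P_CU v n j)"
      by (simp add: con_def algebra_simps flip: sum_distrib_left)
    moreover have "(\<Sum>i\<in>SUs D n. con (C6_SU n i) + con (C8_SU n i) + con (C9_SU n i)) +
        (\<Sum>i\<in>SUs D n. lam (C12 n) * P_SU v n i) - (\<Sum>i\<in>SUs D n. obj_SU n i) =
      (\<Sum>i\<in>SUs D n. off_SU n i) +
        (\<Sum>i\<in>SUs D n. quad_cost (lam (C6_SU n i)) (2 * lam (C6_SU n i) * xSU D n i) (xR v n)) +
        (\<Sum>i\<in>SUs D n. quad_cost (lam (C6_SU n i)) (2 * lam (C6_SU n i) * ySU D n i) (yR v n)) +
        (\<Sum>i\<in>SUs D n. SU_cost D lam v n i)"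
      unfolding con_def off_SU_def obj_SU_def sum.distrib[symmetric] sum_subtractf[symmetric]
      by (intro sum.cong refl SU_terms)
    moreover have "(\<Sum>j\<in>CUs D n. con (C6_CU n j) + con (C8_CU n j) + con (C9_CU n j)) +
        (\<Sum>j\<in>CUs D n. lam (C12 n) * P_CU v n j) - (\<Sum>j\<in>CUs D n. obj_CU n j) =
      (\<Sum>j\<in>CUs D n. off_CU n j) +
        (\<Sum>j\<in>CUs D n. quad_cost (lam (C6_CU n j)) (2 * lam (C6_CU n j) * xCU D n j) (xR v n)) +
        (\<Sum>j\<in>CUs D n. quad_cost (lam (C6_CU n j)) (2 * lam (C6_CU n j) * yCU D n j) (yR v n)) +
        (\<Sum>j\<in>CUs D n. CU_cost D lam v n j)"
      unfolding con_def off_CU_def obj_CU_def sum.distrib[symmetric] sum_subtractf[symmetric]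
      by (intro sum.cong refl CU_terms)
    ultimately show ?thesis
      using relay_terms[of lam v n D]
      unfolding relay_cost_def quad_cost_position off_def con_def[of "C7 n"] con_def[of "C11 n"]
      by linarith
  qed
  have "con C4 = - lam C4 * PS_max D + (\<Sum>n\<in>relays D. lam C4 * P_S2R v n)"
    by (simp add: con_def algebra_simps flip: sum_distrib_left)
  then have "lagrangian D v lam = - lam C4 * PS_max D + (\<Sum>n\<in>relays D.
      lam C4 * P_S2R v n + con (C7 n) + con (C11 n) + con (C12 n) +
      (\<Sum>i\<in>SUs D n. con (C6_SU n i) + con (C8_SU n i) + con (C9_SU n i)) +
      (\<Sum>j\<in>CUs D n. con (C6_CU n j) + con (C8_CU n j) + con (C9_CU n j)) -
      (\<Sum>i\<in>SUs D n. obj_SU n i) - (\<Sum>j\<in>CUs D n. obj_CU n j))"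
    unfolding lagrangian_def F_obj_def con_def[symmetric] obj_SU_def[symmetric]
      obj_CU_def[symmetric] sum_p5_cons
    by (simp add: sum.distrib sum_subtractf)
  then show ?thesis
    unfolding n lagrangian_offset_def off_SU_def[symmetric] off_CU_def[symmetric] off_def[symmetric]
    by (simp add: sum.distrib)
qed

text \<open>The domain restricts each power separately, so one coordinate can be varied alone. The
  \<open>0 +\<close> matches \<open>log_cost\<close> with \<open>a = 0\<close>.\<close>

lemma p5_domain_iff:
  "v \<in> p5_domain D \<longleftrightarrow> (\<forall>n\<in>relays D. 0 < 0 + A_S2R D n * P_S2R v n \<and>
     (\<forall>i\<in>SUs D n. 0 < 1 + A_SU D n i * P_SU v n i) \<and>
     (\<forall>j\<in>CUs D n. 0 < 1 + A_CU D n j * P_CU v n j))"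
  by (simp add: p5_domain_def A_S2R_def A_SU_def A_CU_def)

lemma gain_pos:
  assumes "p5_wf D" "n \<in> relays D"
  shows "0 < A_S2R D n" "i \<in> SUs D n \<Longrightarrow> 0 < A_SU D n i" "j \<in> CUs D n \<Longrightarrow> 0 < A_CU D n j"
  using assms by (auto simp: p5_wf_def A_S2R_def A_SU_def A_CU_def)

lemma rate_weight_pos:
  assumes "p5_wf D" "n \<in> relays D"
  shows "i \<in> SUs D n \<Longrightarrow> 0 < mu1 D * B_SU D n i / (mu2 D * sem_Q D * ln 2)"
    "j \<in> CUs D n \<Longrightarrow> 0 < B_CU D n j / ln 2"
  using assms by (auto simp: p5_wf_def)

lemma p5_cons_mem:
  "C4 \<in> p5_cons D"
  "n \<in> relays D \<Longrightarrow> C7 n \<in> p5_cons D"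
  "n \<in> relays D \<Longrightarrow> C11 n \<in> p5_cons D"
  "n \<in> relays D \<Longrightarrow> C12 n \<in> p5_cons D"
  "n \<in> relays D \<Longrightarrow> i \<in> SUs D n \<Longrightarrow> C6_SU n i \<in> p5_cons D"
  "n \<in> relays D \<Longrightarrow> i \<in> SUs D n \<Longrightarrow> C8_SU n i \<in> p5_cons D"
  "n \<in> relays D \<Longrightarrow> i \<in> SUs D n \<Longrightarrow> C9_SU n i \<in> p5_cons D"
  "n \<in> relays D \<Longrightarrow> j \<in> CUs D n \<Longrightarrow> C6_CU n j \<in> p5_cons D"
  "n \<in> relays D \<Longrightarrow> j \<in> CUs D n \<Longrightarrow> C8_CU n j \<in> p5_cons D"
  "n \<in> relays D \<Longrightarrow> j \<in> CUs D n \<Longrightarrow> C9_CU n j \<in> p5_cons D"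
  unfolding p5_cons_def by blast+

lemma pos_weight_nonneg:
  assumes "lam \<in> dual_feasible D" "n \<in> relays D"
  shows "0 \<le> pos_weight D lam n"
  using assms unfolding pos_weight_def dual_feasible_def
  by (intro add_nonneg_nonneg sum_nonneg) (blast intro: p5_cons_mem)+

section \<open>Stationarity of an optimal solution\<close>

lemma sum_le_imp_summand_le:
  fixes f g :: "'b \<Rightarrow> real"
  assumes "finite S" "a \<in> S" "\<And>x. x \<in> S \<Longrightarrow> x \<noteq> a \<Longrightarrow> g x = f x" "sum f S \<le> sum g S"
  shows "f a \<le> g a"
proof -
  have "sum g (S - {a}) = sum f (S - {a})" using assms(3) by (intro sum.cong) auto
  then show ?thesis using assms by (simp add: sum.remove)
qed

text \<open>The right-hand side \<open>w * A\<close> is positive, which forces \<open>L\<close> to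
  be nonzero. Hence the denominators of the user powers never vanish at an optimum.\<close>

lemma power_eq_of_stationary:
  fixes L w A p :: real
  assumes "0 < A" "0 < w" "L * (1 + A * p) = w * A"
  shows "p = w / L - 1 / A"
proof -
  have "L \<noteq> 0" using assms by auto
  then have "1 + A * p = w / L * A" using assms(3) by (simp add: nonzero_eq_divide_eq mult.commute)
  then have "p = (w / L * A - 1) / A" using assms(1) by (simp add: nonzero_eq_divide_eq mult.commute)
  then show ?thesis using assms(1) by (simp add: diff_divide_distrib)
qed

locale lagrangian_minimizer =
  fixes D v lam
  assumes wf: "p5_wf D" and dom: "v \<in> p5_domain D" and dual: "lam \<in> dual_feasible D"
    and minimal: "\<And>w. w \<in> p5_domain D \<Longrightarrow> lagrangian D v lam \<le> lagrangian D w lam"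
begin

lemma relay_cost_le:
  assumes "n \<in> relays D" "w \<in> p5_domain D"
    and "\<And>n'. n' \<noteq> n \<Longrightarrow> relay_cost D lam w n' = relay_cost D lam v n'"
  shows "relay_cost D lam v n \<le> relay_cost D lam w n"
proof (rule sum_le_imp_summand_le[of "relays D" n "relay_cost D lam w" "relay_cost D lam v"])
  show "sum (relay_cost D lam v) (relays D) \<le> sum (relay_cost D lam w) (relays D)"
    using minimal[OF assms(2)] by (simp only: lagrangian_eq add_le_cancel_left)
qed (use assms in auto)

lemma P_S2R_eq:
  assumes n: "n \<in> relays D" and "lam C4 \<noteq> 0"
  shows "P_S2R v n = 10 * lam (C7 n) / (lam C4 * ln 10)"
proof -
  have A: "0 < A_S2R D n" using gain_pos(1)[OF wf n] .
  have "lam C4 * (0 + A_S2R D n * P_S2R v n) = 10 * lam (C7 n) / ln 10 * A_S2R D n"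
  proof (rule log_cost_minimizer)
    fix q assume q: "0 < 0 + A_S2R D n * q"
    let ?w = "v\<lparr>P_S2R := (P_S2R v)(n := q)\<rparr>"
    have "?w \<in> p5_domain D" using dom q by (auto simp: p5_domain_iff)
    then have "relay_cost D lam v n \<le> relay_cost D lam ?w n"
      using n by (intro relay_cost_le) (auto simp: relay_cost_def SU_cost_def CU_cost_def)
    then show "log_cost (lam C4) (10 * lam (C7 n) / ln 10) 0 (A_S2R D n) (P_S2R v n)
        \<le> log_cost (lam C4) (10 * lam (C7 n) / ln 10) 0 (A_S2R D n) q"
      by (simp add: relay_cost_def SU_cost_def CU_cost_def)
  qed (use A n dom in \<open>auto simp: p5_domain_iff\<close>)
  \<comment> \<open>With \<open>a = 0\<close> the channel gain cancels, so the satellite power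
    depends on the multipliers only.\<close>
  then have "(lam C4 * P_S2R v n) * A_S2R D n = (10 * lam (C7 n) / ln 10) * A_S2R D n"
    by (simp only: add_0_left mult.assoc mult.commute[of "P_S2R v n"])
  then have "lam C4 * P_S2R v n = 10 * lam (C7 n) / ln 10"
    using A by (metis less_irrefl mult_right_cancel)
  then show ?thesis using assms(2) by (simp add: field_simps)
qed

lemma position_eq:
  assumes n: "n \<in> relays D" and "pos_weight D lam n \<noteq> 0"
  shows "xR v n = x_moment D lam n / pos_weight D lam n"
    "yR v n = y_moment D lam n / pos_weight D lam n"
proof -
  note nonneg = pos_weight_nonneg[OF dual n]
  have "xR v n = 2 * x_moment D lam n / (2 * pos_weight D lam n)"
  proof (rule quad_cost_minimizer[OF nonneg assms(2)])
    fix q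
    let ?w = "v\<lparr>xR := (xR v)(n := q)\<rparr>"
    have "?w \<in> p5_domain D" using dom by (auto simp: p5_domain_iff)
    then have "relay_cost D lam v n \<le> relay_cost D lam ?w n"
      using n by (intro relay_cost_le) (auto simp: relay_cost_def SU_cost_def CU_cost_def)
    then show "quad_cost (pos_weight D lam n) (2 * x_moment D lam n) (xR v n)
        \<le> quad_cost (pos_weight D lam n) (2 * x_moment D lam n) q"
      by (simp add: relay_cost_def SU_cost_def CU_cost_def)
  qed
  then show "xR v n = x_moment D lam n / pos_weight D lam n" by simp
  have "yR v n = 2 * y_moment D lam n / (2 * pos_weight D lam n)"
  proof (rule quad_cost_minimizer[OF nonneg assms(2)])
    fix q
    let ?w = "v\<lparr>yR := (yR v)(n := q)\<rparr>"
    have "?w \<in> p5_domain D" using dom by (auto simp: p5_domain_iff)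
    then have "relay_cost D lam v n \<le> relay_cost D lam ?w n"
      using n by (intro relay_cost_le) (auto simp: relay_cost_def SU_cost_def CU_cost_def)
    then show "quad_cost (pos_weight D lam n) (2 * y_moment D lam n) (yR v n)
        \<le> quad_cost (pos_weight D lam n) (2 * y_moment D lam n) q"
      by (simp add: relay_cost_def SU_cost_def CU_cost_def)
  qed
  then show "yR v n = y_moment D lam n / pos_weight D lam n" by simp
qed

lemma r_S2R_eq:
  assumes n: "n \<in> relays D" and "lam (C11 n) \<noteq> 0"
  shows "r_S2R v n = E_const D n - ln (lam (C7 n) / lam (C11 n))"
proof (rule exp_cost_minimizer[OF assms(2)])
  fix q
  let ?w = "v\<lparr>r_S2R := (r_S2R v)(n := q)\<rparr>"
  have "?w \<in> p5_domain D" using dom by (auto simp: p5_domain_iff)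
  then have "relay_cost D lam v n \<le> relay_cost D lam ?w n"
    using n by (intro relay_cost_le) (auto simp: relay_cost_def SU_cost_def CU_cost_def)
  then show "exp_cost (lam (C7 n)) (lam (C11 n)) (E_const D n) (r_S2R v n)
      \<le> exp_cost (lam (C7 n)) (lam (C11 n)) (E_const D n) q"
    by (simp add: relay_cost_def SU_cost_def CU_cost_def)
qed

text \<open>Power and SNR bound are varied together; keeping either at its old value isolates the
  cost of the other.\<close>

lemma SU_cost_le:
  fixes q g :: real
  assumes n: "n \<in> relays D" and i: "i \<in> SUs D n"
    and q: "0 < 1 + A_SU D n i * q"
  defines "w \<equiv> v\<lparr>P_SU := (P_SU v)(n := (P_SU v n)(i := q)),
    gam_SU := (gam_SU v)(n := (gam_SU v n)(i := g))\<rparr>"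
  shows "SU_cost D lam v n i \<le> SU_cost D lam w n i"
proof -
  have "w \<in> p5_domain D" using dom q by (auto simp: p5_domain_iff w_def)
  then have "relay_cost D lam v n \<le> relay_cost D lam w n"
    using n by (intro relay_cost_le) (auto simp: relay_cost_def SU_cost_def CU_cost_def w_def)
  then have "(\<Sum>i\<in>SUs D n. SU_cost D lam v n i) \<le> (\<Sum>i\<in>SUs D n. SU_cost D lam w n i)"
    by (simp add: relay_cost_def CU_cost_def w_def)
  then show ?thesis
    using i
    by (intro sum_le_imp_summand_le[of "SUs D n" i "SU_cost D lam w n" "SU_cost D lam v n"])
      (auto simp: SU_cost_def w_def)
qed

lemma CU_cost_le:
  fixes q g :: real
  assumes n: "n \<in> relays D" and j: "j \<in> CUs D n"
    and q: "0 < 1 + A_CU D n j * q"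
  defines "w \<equiv> v\<lparr>P_CU := (P_CU v)(n := (P_CU v n)(j := q)),
    gam_CU := (gam_CU v)(n := (gam_CU v n)(j := g))\<rparr>"
  shows "CU_cost D lam v n j \<le> CU_cost D lam w n j"
proof -
  have "w \<in> p5_domain D" using dom q by (auto simp: p5_domain_iff w_def)
  then have "relay_cost D lam v n \<le> relay_cost D lam w n"
    using n by (intro relay_cost_le) (auto simp: relay_cost_def SU_cost_def CU_cost_def w_def)
  then have "(\<Sum>j\<in>CUs D n. CU_cost D lam v n j) \<le> (\<Sum>j\<in>CUs D n. CU_cost D lam w n j)"
    by (simp add: relay_cost_def SU_cost_def w_def)
  then show ?thesis
    using j
    by (intro sum_le_imp_summand_le[of "CUs D n" j "CU_cost D lam w n" "CU_cost D lam v n"])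
      (auto simp: CU_cost_def w_def)
qed

lemma P_SU_eq:
  assumes n: "n \<in> relays D" and i: "i \<in> SUs D n"
  shows "P_SU v n i = (mu1 D * B_SU D n i / (mu2 D * sem_Q D * ln 2)) /
    (lam (C8_SU n i) * A_SU D n i + lam (C12 n)) - 1 / A_SU D n i"
proof (rule power_eq_of_stationary)
  show A: "0 < A_SU D n i" using gain_pos(2)[OF wf n i] .
  show "0 < mu1 D * B_SU D n i / (mu2 D * sem_Q D * ln 2)"
    using rate_weight_pos(1)[OF wf n i] .
  show "(lam (C8_SU n i) * A_SU D n i + lam (C12 n)) * (1 + A_SU D n i * P_SU v n i) =
      mu1 D * B_SU D n i / (mu2 D * sem_Q D * ln 2) * A_SU D n i"
  proof (rule log_cost_minimizer)
    show "0 < 1 + A_SU D n i * P_SU v n i" "A_SU D n i \<noteq> 0"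
      using A n i dom by (auto simp: p5_domain_iff)
  qed (use SU_cost_le[OF n i, of _ "gam_SU v n i"] in \<open>simp add: SU_cost_def\<close>)
qed

lemma P_CU_eq:
  assumes n: "n \<in> relays D" and j: "j \<in> CUs D n"
  shows "P_CU v n j = (B_CU D n j / ln 2) /
    (lam (C8_CU n j) * A_CU D n j + lam (C12 n)) - 1 / A_CU D n j"
proof (rule power_eq_of_stationary)
  show A: "0 < A_CU D n j" using gain_pos(3)[OF wf n j] .
  show "0 < B_CU D n j / ln 2"
    using rate_weight_pos(2)[OF wf n j] .
  show "(lam (C8_CU n j) * A_CU D n j + lam (C12 n)) * (1 + A_CU D n j * P_CU v n j) =
      B_CU D n j / ln 2 * A_CU D n j"
  proof (rule log_cost_minimizer)
    show "0 < 1 + A_CU D n j * P_CU v n j" "A_CU D n j \<noteq> 0"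
      using A n j dom by (auto simp: p5_domain_iff)
  qed (use CU_cost_le[OF n j, of _ "gam_CU v n j"] in \<open>simp add: CU_cost_def\<close>)
qed

lemma gam_SU_eq:
  assumes n: "n \<in> relays D" and i: "i \<in> SUs D n" and "lam (C9_SU n i) \<noteq> 0"
  shows "gam_SU v n i = (lam (C8_SU n i) + lam (C9_SU n i) * (2 powr eta_SU D n i - 1)) /
    (2 * lam (C9_SU n i))"
proof (rule quad_cost_minimizer[OF _ assms(3)])
  show "0 \<le> lam (C9_SU n i)" using dual n i by (simp add: dual_feasible_def p5_cons_mem)
  have "0 < 1 + A_SU D n i * P_SU v n i" using n i dom by (auto simp: p5_domain_iff)
  from SU_cost_le[OF n i this]
  show "quad_cost (lam (C9_SU n i)) (lam (C8_SU n i) + lam (C9_SU n i) * (2 powr eta_SU D n i - 1))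
      (gam_SU v n i) \<le> quad_cost (lam (C9_SU n i))
      (lam (C8_SU n i) + lam (C9_SU n i) * (2 powr eta_SU D n i - 1)) g" for g
    by (simp add: SU_cost_def)
qed

lemma gam_CU_eq:
  assumes n: "n \<in> relays D" and j: "j \<in> CUs D n" and "lam (C9_CU n j) \<noteq> 0"
  shows "gam_CU v n j = (lam (C8_CU n j) + lam (C9_CU n j) * (2 powr eta_CU D n j - 1)) /
    (2 * lam (C9_CU n j))"
proof (rule quad_cost_minimizer[OF _ assms(3)])
  show "0 \<le> lam (C9_CU n j)" using dual n j by (simp add: dual_feasible_def p5_cons_mem)
  have "0 < 1 + A_CU D n j * P_CU v n j" using n j dom by (auto simp: p5_domain_iff)
  from CU_cost_le[OF n j this]
  show "quad_cost (lam (C9_CU n j)) (lam (C8_CU n j) + lam (C9_CU n j) * (2 powr eta_CU D n j - 1))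
      (gam_CU v n j) \<le> quad_cost (lam (C9_CU n j))
      (lam (C8_CU n j) + lam (C9_CU n j) * (2 powr eta_CU D n j - 1)) g" for g
    by (simp add: CU_cost_def)
qed

end

section \<open>Limits of the primal-dual algorithm\<close>

text \<open>The Lagrangian is affine in a single multiplier, with the constraint value as
  slope.\<close>

lemma deriv_lagrangian_dual:
  assumes "m \<in> p5_cons D"
  shows "deriv (\<lambda>t. lagrangian D v (lam(m := t))) t0 = con_fun D m v"
proof -
  define c where "c = - F_obj D v + (\<Sum>m'\<in>p5_cons D - {m}. lam m' * con_fun D m' v)"
  have "lagrangian D v (lam(m := t)) = c + t * con_fun D m v" for t
  proof -
    have "(\<Sum>m'\<in>p5_cons D - {m}. (lam(m := t)) m' * con_fun D m' v)
        = (\<Sum>m'\<in>p5_cons D - {m}. lam m' * con_fun D m' v)"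
      by (intro sum.cong) auto
    then show ?thesis
      unfolding lagrangian_def c_def using assms by (subst sum.remove[of _ m]) auto
  qed
  moreover have "((\<lambda>t. c + t * con_fun D m v) has_real_derivative con_fun D m v) (at t0)"
    by (auto intro!: derivative_eq_intros)
  ultimately show ?thesis by (simp add: DERIV_imp_deriv)
qed

text \<open>If \<open>c\<close> were positive, \<open>s k\<close> would eventually be at most
  \<open>2 / c\<close> times the increment of \<open>a\<close>. These increments telescope to a
  convergent series, so \<open>s\<close> would be summable.\<close>

lemma nonsummable_steps_drift_nonpos:
  fixes a s d :: "nat \<Rightarrow> real"
  assumes step: "\<And>k. a (Suc k) = a k + s k * d k" and "\<And>k. 0 < s k" "\<not> summable s"
    and "a \<longlonglongrightarrow> L" "d \<longlonglongrightarrow> c"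
  shows "c \<le> 0"
proof (rule ccontr)
  assume "\<not> c \<le> 0"
  then have c: "0 < c" by simp
  then have "eventually (\<lambda>k. c / 2 < d k) sequentially"
    using order_tendstoD(1)[OF assms(5), of "c / 2"] by simp
  then have "eventually (\<lambda>k. norm (s k) \<le> 2 / c * (a (Suc k) - a k)) sequentially"
  proof eventually_elim
    case (elim k)
    then have "s k * (c / 2) \<le> s k * d k" using assms(2)[of k] by simp
    then show ?case using step[of k] c assms(2)[of k] by (simp add: field_simps)
  qed
  moreover have "summable (\<lambda>k. 2 / c * (a (Suc k) - a k))"
    using telescope_summable[OF assms(4)] by (rule summable_mult)
  ultimately have "summable s" by (rule summable_comparison_test_ev)
  then show False using assms(3) by simp
qed

lemma nonsummable_steps_drift_zero:
  fixes a s d :: "nat \<Rightarrow> real"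
  assumes step: "\<And>k. a (Suc k) = a k + s k * d k" and "\<And>k. 0 < s k" "\<not> summable s"
    and "a \<longlonglongrightarrow> L" "d \<longlonglongrightarrow> c"
  shows "c = 0"
proof -
  have "- c \<le> 0"
    using assms(2-)
    by (intro nonsummable_steps_drift_nonpos[of "\<lambda>k. - a k" s "\<lambda>k. - d k" "- L"])
      (auto intro: tendsto_minus simp: step)
  moreover have "c \<le> 0" using assms by (rule nonsummable_steps_drift_nonpos)
  ultimately show ?thesis by simp
qed

section \<open>Saddle point property of the limit\<close>

lemma power_stationary:
  fixes L w A :: real
  assumes "0 < A" "0 < w" "0 \<le> L" "L \<noteq> 0"
  shows "0 < 1 + A * (w / L - 1 / A)" "L * (1 + A * (w / L - 1 / A)) = w * A"
proof -
  have "1 + A * (w / L - 1 / A) = A * w / L" using assms by (simp add: field_simps)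
  then show "0 < 1 + A * (w / L - 1 / A)" "L * (1 + A * (w / L - 1 / A)) = w * A"
    using assms by auto
qed

text \<open>The closed form must be defined at the limit alone; an iterate may still evaluate it
  with the default values of division and \<open>ln\<close>.\<close>

locale dual_limit =
  fixes D :: p5_data and l :: "p5_con \<Rightarrow> real"
  assumes wf: "p5_wf D" and dual: "l \<in> dual_feasible D" and cf_defined: "closed_form_defined D l"
begin

lemma multiplier_nonneg: "m \<in> p5_cons D \<Longrightarrow> 0 \<le> l m"
  using dual by (simp add: dual_feasible_def)

lemma C4_pos: "0 < l C4"
  using cf_defined multiplier_nonneg[OF p5_cons_mem(1)]
  by (auto simp: closed_form_defined_def order_less_le)

lemma C7_pos: "n \<in> relays D \<Longrightarrow> 0 < l (C7 n)"
  using cf_defined multiplier_nonneg[OF p5_cons_mem(2), of n] multiplier_nonneg[OF p5_cons_mem(3), of n]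
  by (auto simp: closed_form_defined_def zero_less_divide_iff)

lemma S2R_stationary:
  assumes n: "n \<in> relays D"
  shows "0 < 0 + A_S2R D n * P_S2R (closed_form D l) n"
    "l C4 * (0 + A_S2R D n * P_S2R (closed_form D l) n) = 10 * l (C7 n) / ln 10 * A_S2R D n"
  using gain_pos(1)[OF wf n] C4_pos C7_pos[OF n] by (auto simp: closed_form_def)

lemma SU_stationary:
  assumes n: "n \<in> relays D" and i: "i \<in> SUs D n"
  shows "0 < 1 + A_SU D n i * P_SU (closed_form D l) n i"
    "(l (C8_SU n i) * A_SU D n i + l (C12 n)) * (1 + A_SU D n i * P_SU (closed_form D l) n i) =
      mu1 D * B_SU D n i / (mu2 D * sem_Q D * ln 2) * A_SU D n i"
proof -
  have A: "0 < A_SU D n i" using gain_pos(2)[OF wf n i] .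
  have w: "0 < mu1 D * B_SU D n i / (mu2 D * sem_Q D * ln 2)"
    using rate_weight_pos(1)[OF wf n i] .
  have "0 \<le> l (C8_SU n i) * A_SU D n i + l (C12 n)"
    using A n i by (intro add_nonneg_nonneg mult_nonneg_nonneg multiplier_nonneg p5_cons_mem) auto
  moreover have "l (C8_SU n i) * A_SU D n i + l (C12 n) \<noteq> 0"
    using cf_defined n i by (simp add: closed_form_defined_def)
  ultimately show "0 < 1 + A_SU D n i * P_SU (closed_form D l) n i"
    "(l (C8_SU n i) * A_SU D n i + l (C12 n)) * (1 + A_SU D n i * P_SU (closed_form D l) n i) =
      mu1 D * B_SU D n i / (mu2 D * sem_Q D * ln 2) * A_SU D n i"
    unfolding closed_form_def p5_vars.simps using power_stationary[OF A w] by blast+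
qed

lemma CU_stationary:
  assumes n: "n \<in> relays D" and j: "j \<in> CUs D n"
  shows "0 < 1 + A_CU D n j * P_CU (closed_form D l) n j"
    "(l (C8_CU n j) * A_CU D n j + l (C12 n)) * (1 + A_CU D n j * P_CU (closed_form D l) n j) =
      B_CU D n j / ln 2 * A_CU D n j"
proof -
  have A: "0 < A_CU D n j" using gain_pos(3)[OF wf n j] .
  have w: "0 < B_CU D n j / ln 2"
    using rate_weight_pos(2)[OF wf n j] .
  have "0 \<le> l (C8_CU n j) * A_CU D n j + l (C12 n)"
    using A n j by (intro add_nonneg_nonneg mult_nonneg_nonneg multiplier_nonneg p5_cons_mem) auto
  moreover have "l (C8_CU n j) * A_CU D n j + l (C12 n) \<noteq> 0"
    using cf_defined n j by (simp add: closed_form_defined_def)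
  ultimately show "0 < 1 + A_CU D n j * P_CU (closed_form D l) n j"
    "(l (C8_CU n j) * A_CU D n j + l (C12 n)) * (1 + A_CU D n j * P_CU (closed_form D l) n j) =
      B_CU D n j / ln 2 * A_CU D n j"
    unfolding closed_form_def p5_vars.simps using power_stationary[OF A w] by blast+
qed

lemma closed_form_domain: "closed_form D l \<in> p5_domain D"
  using S2R_stationary(1) SU_stationary(1) CU_stationary(1) by (simp only: p5_domain_iff) blast

lemma closed_form_minimizes_lagrangian:
  assumes "w \<in> p5_domain D"
  shows "lagrangian D (closed_form D l) l \<le> lagrangian D w l"
proof -
  have "relay_cost D l (closed_form D l) n \<le> relay_cost D l w n" if n: "n \<in> relays D" for n
  proof -
    have w: "0 < 0 + A_S2R D n * P_S2R w n"
      "\<And>i. i \<in> SUs D n \<Longrightarrow> 0 < 1 + A_SU D n i * P_SU w n i"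
      "\<And>j. j \<in> CUs D n \<Longrightarrow> 0 < 1 + A_CU D n j * P_CU w n j"
      using assms n by (simp_all only: p5_domain_iff)
    \<comment> \<open>The linear coefficient is twice the moment, so the vertex
      \<open>2 * b / (2 * a)\<close> becomes the weighted mean.\<close>
    have position: "quad_cost (pos_weight D l n) (2 * b) (b / pos_weight D l n)
        \<le> quad_cost (pos_weight D l n) (2 * b) z" for b z
      using quad_cost_stationary[OF pos_weight_nonneg[OF dual n], of "2 * b" z] cf_defined n
      by (simp add: closed_form_defined_def)
    have "SU_cost D l (closed_form D l) n i \<le> SU_cost D l w n i" if i: "i \<in> SUs D n" for i
      unfolding SU_cost_def
    proof (rule add_mono)
      show "log_cost (l (C8_SU n i) * A_SU D n i + l (C12 n))
          (mu1 D * B_SU D n i / (mu2 D * sem_Q D * ln 2)) 1 (A_SU D n i) (P_SU (closed_form D l) n i)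
        \<le> log_cost (l (C8_SU n i) * A_SU D n i + l (C12 n))
          (mu1 D * B_SU D n i / (mu2 D * sem_Q D * ln 2)) 1 (A_SU D n i) (P_SU w n i)"
        using n i less_imp_le[OF rate_weight_pos(1)[OF wf n i]]
        by (intro log_cost_stationary SU_stationary w)
      have "l (C9_SU n i) \<noteq> 0" using cf_defined n i by (simp add: closed_form_defined_def)
      then show "quad_cost (l (C9_SU n i))
          (l (C8_SU n i) + l (C9_SU n i) * (2 powr eta_SU D n i - 1)) (gam_SU (closed_form D l) n i)
        \<le> quad_cost (l (C9_SU n i))
          (l (C8_SU n i) + l (C9_SU n i) * (2 powr eta_SU D n i - 1)) (gam_SU w n i)"
        using n i unfolding closed_form_def p5_vars.simps
        by (intro quad_cost_stationary multiplier_nonneg p5_cons_mem)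
    qed
    moreover have "CU_cost D l (closed_form D l) n j \<le> CU_cost D l w n j" if j: "j \<in> CUs D n" for j
      unfolding CU_cost_def
    proof (rule add_mono)
      show "log_cost (l (C8_CU n j) * A_CU D n j + l (C12 n))
          (B_CU D n j / ln 2) 1 (A_CU D n j) (P_CU (closed_form D l) n j)
        \<le> log_cost (l (C8_CU n j) * A_CU D n j + l (C12 n))
          (B_CU D n j / ln 2) 1 (A_CU D n j) (P_CU w n j)"
        using n j less_imp_le[OF rate_weight_pos(2)[OF wf n j]]
        by (intro log_cost_stationary CU_stationary w)
      have "l (C9_CU n j) \<noteq> 0" using cf_defined n j by (simp add: closed_form_defined_def)
      then show "quad_cost (l (C9_CU n j))
          (l (C8_CU n j) + l (C9_CU n j) * (2 powr eta_CU D n j - 1)) (gam_CU (closed_form D l) n j)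
        \<le> quad_cost (l (C9_CU n j))
          (l (C8_CU n j) + l (C9_CU n j) * (2 powr eta_CU D n j - 1)) (gam_CU w n j)"
        using n j unfolding closed_form_def p5_vars.simps
        by (intro quad_cost_stationary multiplier_nonneg p5_cons_mem)
    qed
    moreover have "log_cost (l C4) (10 * l (C7 n) / ln 10) 0 (A_S2R D n) (P_S2R (closed_form D l) n)
        \<le> log_cost (l C4) (10 * l (C7 n) / ln 10) 0 (A_S2R D n) (P_S2R w n)"
      using C7_pos[OF n] by (intro log_cost_stationary S2R_stationary[OF n] w) simp
    moreover have "exp_cost (l (C7 n)) (l (C11 n)) (E_const D n) (r_S2R (closed_form D l) n)
        \<le> exp_cost (l (C7 n)) (l (C11 n)) (E_const D n) (r_S2R w n)"
      using cf_defined n unfolding closed_form_def p5_vars.simps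
      by (intro exp_cost_stationary multiplier_nonneg p5_cons_mem) (auto simp: closed_form_defined_def)
    moreover have "xR (closed_form D l) n = x_moment D l n / pos_weight D l n"
      "yR (closed_form D l) n = y_moment D l n / pos_weight D l n"
      by (simp_all add: closed_form_def x_moment_def y_moment_def)
    ultimately show ?thesis
      unfolding relay_cost_def by (simp only:) (intro add_mono sum_mono position)
  qed
  then show ?thesis unfolding lagrangian_eq by (intro add_left_mono sum_mono)
qed

lemma data_nonzero:
  "mu2 D \<noteq> 0" "sem_Q D \<noteq> 0" "noise D \<noteq> 0"
  "n \<in> relays D \<Longrightarrow> B_S2R D n \<noteq> 0"
  "n \<in> relays D \<Longrightarrow> i \<in> SUs D n \<Longrightarrow> B_SU D n i \<noteq> 0"
  "n \<in> relays D \<Longrightarrow> j \<in> CUs D n \<Longrightarrow> B_CU D n j \<noteq> 0"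
  using wf unfolding p5_wf_def by (metis less_irrefl)+

lemma closed_form_tendsto:
  assumes lim: "\<And>m. m \<in> p5_cons D \<Longrightarrow> (\<lambda>k. lam k m) \<longlonglongrightarrow> l m" and n: "n \<in> relays D"
  shows "(\<lambda>k. P_S2R (closed_form D (lam k)) n) \<longlonglongrightarrow> P_S2R (closed_form D l) n"
    "i \<in> SUs D n \<Longrightarrow> (\<lambda>k. P_SU (closed_form D (lam k)) n i) \<longlonglongrightarrow> P_SU (closed_form D l) n i"
    "j \<in> CUs D n \<Longrightarrow> (\<lambda>k. P_CU (closed_form D (lam k)) n j) \<longlonglongrightarrow> P_CU (closed_form D l) n j"
    "(\<lambda>k. xR (closed_form D (lam k)) n) \<longlonglongrightarrow> xR (closed_form D l) n"
    "(\<lambda>k. yR (closed_form D (lam k)) n) \<longlonglongrightarrow> yR (closed_form D l) n"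
    "(\<lambda>k. r_S2R (closed_form D (lam k)) n) \<longlonglongrightarrow> r_S2R (closed_form D l) n"
    "i \<in> SUs D n \<Longrightarrow> (\<lambda>k. gam_SU (closed_form D (lam k)) n i) \<longlonglongrightarrow> gam_SU (closed_form D l) n i"
    "j \<in> CUs D n \<Longrightarrow> (\<lambda>k. gam_CU (closed_form D (lam k)) n j) \<longlonglongrightarrow> gam_CU (closed_form D l) n j"
  using cf_defined n data_nonzero(1,2) C7_pos[OF n]
  unfolding closed_form_def p5_vars.simps pos_weight_def
  by (auto intro!: tendsto_intros lim p5_cons_mem simp: closed_form_defined_def pos_weight_def)

lemma con_fun_tendsto:
  assumes lim: "\<And>m. m \<in> p5_cons D \<Longrightarrow> (\<lambda>k. lam k m) \<longlonglongrightarrow> l m" and m: "m \<in> p5_cons D"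
  shows "(\<lambda>k. con_fun D m (closed_form D (lam k))) \<longlonglongrightarrow> con_fun D m (closed_form D l)"
proof -
  note cf = closed_form_tendsto[of lam, OF lim]
  show ?thesis
  proof (cases m)
    case (C7 n)
    then have n: "n \<in> relays D" using m by (auto simp: p5_cons_def)
    \<comment> \<open>Continuity of the logarithm in \<open>C7\<close> at the limit point rests on
      that point lying in the domain.\<close>
    have "0 < (cmod (chan D n))\<^sup>2 * P_S2R (closed_form D l) n / (noise D * B_S2R D n)"
      using closed_form_domain n by (auto simp: p5_domain_def)
    then show ?thesis
      unfolding C7 con_fun.simps by (intro tendsto_intros cf n) (use data_nonzero n in auto)
  qed (use m in \<open>auto simp: p5_cons_def norm_sq_uav data_nonzero intro!: tendsto_intros cf\<close>)
qed

text \<open>With all constraint values zero, Lagrangian and objective agree at the closed form. Its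
  value is then a lower bound for the primal and is reached by the dual function, so weak duality
  certifies both optima.\<close>

lemma limit_optimal:
  assumes "\<And>m. m \<in> p5_cons D \<Longrightarrow> con_fun D m (closed_form D l) = 0"
  shows "p5_optimal D (closed_form D l) \<and> dual_optimal D l"
proof -
  let ?v = "closed_form D l"
  have feas: "?v \<in> p5_feasible D" using closed_form_domain assms by (simp add: p5_feasible_def)
  have L: "lagrangian D ?v l = - F_obj D ?v" using assms by (simp add: lagrangian_def)
  have "- F_obj D ?v \<le> - F_obj D w" if w: "w \<in> p5_feasible D" for w
  proof -
    have "w \<in> p5_domain D" using w by (simp add: p5_feasible_def)
    then have "lagrangian D ?v l \<le> lagrangian D w l" by (rule closed_form_minimizes_lagrangian)
    also have "\<dots> \<le> - F_obj D w" using w dual by (rule lagrangian_le_objective)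
    finally show ?thesis by (simp add: L)
  qed
  moreover have "ereal (- F_obj D ?v) \<le> dual_fun D l"
    unfolding dual_fun_def L[symmetric] using closed_form_minimizes_lagrangian
    by (intro INF_greatest) simp
  then have "dual_fun D l' \<le> dual_fun D l" if "l' \<in> dual_feasible D" for l'
    using weak_duality[OF feas that] by (rule order_trans[rotated])
  ultimately show ?thesis using feas dual by (auto simp: p5_optimal_def dual_optimal_def)
qed

end

lemma primal_dual_limit_optimal:
  assumes wf: "p5_wf D"
    and s: "\<And>k m. m \<in> p5_cons D \<Longrightarrow> 0 < s k m" "\<And>m. m \<in> p5_cons D \<Longrightarrow> \<not> summable (\<lambda>k. s k m)"
    and run: "primal_dual_run D s v lam"
    and lim: "\<And>m. m \<in> p5_cons D \<Longrightarrow> (\<lambda>k. lam k m) \<longlonglongrightarrow> l m"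
    and l: "l \<in> dual_feasible D" "closed_form_defined D l"
  shows "p5_optimal D (closed_form D l) \<and> dual_optimal D l"
proof -
  interpret dual_limit D l using wf l by unfold_locales
  show ?thesis
  proof (rule limit_optimal)
    fix m assume m: "m \<in> p5_cons D"
    show "con_fun D m (closed_form D l) = 0"
    proof (rule nonsummable_steps_drift_zero)
      show "lam (Suc k) m = lam k m + s k m * con_fun D m (closed_form D (lam k))" for k
        using run m by (simp add: primal_dual_run_def deriv_lagrangian_dual)
    qed (use m s lim con_fun_tendsto[OF lim m] in auto)
  qed
qed

text \<open>The conditions on nonzero multipliers mark the denominators that optimality alone does
  not control. Convergence of a run is a hypothesis, and its limit is then certified as
  optimal.\<close>

theorem lemma4:
  fixes D :: p5_data
  assumes "p5_wf D"
  shows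
    "(slater D \<longrightarrow> strong_duality D \<and> (\<exists>lam. dual_optimal D lam)) \<and>
     (\<forall>v lam. p5_optimal D v \<and> dual_optimal D lam \<and> strong_duality D \<longrightarrow>
       (\<forall>n\<in>relays D.
         (lam C4 \<noteq> 0 \<longrightarrow> P_S2R v n = 10 * lam (C7 n) / (lam C4 * ln 10)) \<and>
         (\<forall>i\<in>SUs D n.
            P_SU v n i = (mu1 D * B_SU D n i / (mu2 D * sem_Q D * ln 2)) /
              (lam (C8_SU n i) * A_SU D n i + lam (C12 n)) - 1 / A_SU D n i) \<and>
         (\<forall>j\<in>CUs D n.
            P_CU v n j = (B_CU D n j / ln 2) /
              (lam (C8_CU n j) * A_CU D n j + lam (C12 n)) - 1 / A_CU D n j) \<and>
         (pos_weight D lam n \<noteq> 0 \<longrightarrow>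
            uav_pos D v n =
              (((\<Sum>i\<in>SUs D n. lam (C6_SU n i) * xSU D n i) +
                (\<Sum>j\<in>CUs D n. lam (C6_CU n j) * xCU D n j)) /
               ((\<Sum>i\<in>SUs D n. lam (C6_SU n i)) + (\<Sum>j\<in>CUs D n. lam (C6_CU n j))),
               ((\<Sum>i\<in>SUs D n. lam (C6_SU n i) * ySU D n i) +
                (\<Sum>j\<in>CUs D n. lam (C6_CU n j) * yCU D n j)) /
               ((\<Sum>i\<in>SUs D n. lam (C6_SU n i)) + (\<Sum>j\<in>CUs D n. lam (C6_CU n j))),
               height D)) \<and>
         (lam (C11 n) \<noteq> 0 \<longrightarrow> r_S2R v n = E_const D n - ln (lam (C7 n) / lam (C11 n))) \<and>
         (\<forall>i\<in>SUs D n. lam (C9_SU n i) \<noteq> 0 \<longrightarrow>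
            gam_SU v n i =
              (lam (C8_SU n i) + lam (C9_SU n i) * (2 powr eta_SU D n i - 1)) /
              (2 * lam (C9_SU n i))) \<and>
         (\<forall>j\<in>CUs D n. lam (C9_CU n j) \<noteq> 0 \<longrightarrow>
            gam_CU v n j =
              (lam (C8_CU n j) + lam (C9_CU n j) * (2 powr eta_CU D n j - 1)) /
              (2 * lam (C9_CU n j))))) \<and>
     (\<forall>s v lam lam'.
       (\<forall>k. \<forall>m\<in>p5_cons D. s k m > 0) \<and> (\<forall>m\<in>p5_cons D. \<not> summable (\<lambda>k. s k m)) \<and>
       primal_dual_run D s v lam \<and>
       (\<forall>m\<in>p5_cons D. (\<lambda>k. lam k m) \<longlonglongrightarrow> lam' m) \<and>
       lam' \<in> dual_feasible D \<and> closed_form_defined D lam' \<longrightarrow>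
       p5_optimal D (closed_form D lam') \<and> dual_optimal D lam')"
proof (intro conjI allI impI)
  assume "slater D"
  then show "strong_duality D" "\<exists>lam. dual_optimal D lam"
    using slater_duality[OF assms] by auto
next
  fix v lam
  assume *: "p5_optimal D v \<and> dual_optimal D lam \<and> strong_duality D"
  then interpret lagrangian_minimizer D v lam
    using assms optimal_minimizes_lagrangian
    by unfold_locales (auto simp: p5_optimal_def p5_feasible_def dual_optimal_def)
  show "\<forall>n\<in>relays D.
         (lam C4 \<noteq> 0 \<longrightarrow> P_S2R v n = 10 * lam (C7 n) / (lam C4 * ln 10)) \<and>
         (\<forall>i\<in>SUs D n.
            P_SU v n i = (mu1 D * B_SU D n i / (mu2 D * sem_Q D * ln 2)) /
              (lam (C8_SU n i) * A_SU D n i + lam (C12 n)) - 1 / A_SU D n i) \<and>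
         (\<forall>j\<in>CUs D n.
            P_CU v n j = (B_CU D n j / ln 2) /
              (lam (C8_CU n j) * A_CU D n j + lam (C12 n)) - 1 / A_CU D n j) \<and>
         (pos_weight D lam n \<noteq> 0 \<longrightarrow>
            uav_pos D v n =
              (((\<Sum>i\<in>SUs D n. lam (C6_SU n i) * xSU D n i) +
                (\<Sum>j\<in>CUs D n. lam (C6_CU n j) * xCU D n j)) /
               ((\<Sum>i\<in>SUs D n. lam (C6_SU n i)) + (\<Sum>j\<in>CUs D n. lam (C6_CU n j))),
               ((\<Sum>i\<in>SUs D n. lam (C6_SU n i) * ySU D n i) +
                (\<Sum>j\<in>CUs D n. lam (C6_CU n j) * yCU D n j)) /
               ((\<Sum>i\<in>SUs D n. lam (C6_SU n i)) + (\<Sum>j\<in>CUs D n. lam (C6_CU n j))),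
               height D)) \<and>
         (lam (C11 n) \<noteq> 0 \<longrightarrow> r_S2R v n = E_const D n - ln (lam (C7 n) / lam (C11 n))) \<and>
         (\<forall>i\<in>SUs D n. lam (C9_SU n i) \<noteq> 0 \<longrightarrow>
            gam_SU v n i =
              (lam (C8_SU n i) + lam (C9_SU n i) * (2 powr eta_SU D n i - 1)) /
              (2 * lam (C9_SU n i))) \<and>
         (\<forall>j\<in>CUs D n. lam (C9_CU n j) \<noteq> 0 \<longrightarrow>
            gam_CU v n j =
              (lam (C8_CU n j) + lam (C9_CU n j) * (2 powr eta_CU D n j - 1)) /
              (2 * lam (C9_CU n j)))"
    \<comment> \<open>\<open>pos_weight\<close> stays folded at first so that its nonzero condition
      can discharge the premise of \<open>position_eq\<close>.\<close>
    by (simp add: P_S2R_eq P_SU_eq P_CU_eq r_S2R_eq gam_SU_eq gam_CU_eq uav_pos_def position_eq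
        x_moment_def y_moment_def) (simp add: pos_weight_def)
next
  fix s v lam lam'
  assume "(\<forall>k. \<forall>m\<in>p5_cons D. s k m > 0) \<and> (\<forall>m\<in>p5_cons D. \<not> summable (\<lambda>k. s k m)) \<and>
    primal_dual_run D s v lam \<and> (\<forall>m\<in>p5_cons D. (\<lambda>k. lam k m) \<longlonglongrightarrow> lam' m) \<and>
    lam' \<in> dual_feasible D \<and> closed_form_defined D lam'"
  then show "p5_optimal D (closed_form D lam')" "dual_optimal D lam'"
    using primal_dual_limit_optimal[OF assms, of s v lam lam'] by auto
qed

end
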